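(* Let $(\mathfrak M,\Phi,\varphi)$ be a quantum dynamical system with $\varphi$-adjoint $\Phi^\sharp$, GNS representation $(\mathcal H_\varphi,\pi_\varphi,\Omega_\varphi)$ and associated contraction $U=U_{\Phi,\varphi}$ on $\mathcal H_\varphi$. Let $\mathcal H_\infty=\overline{\pi_\varphi(\mathfrak D_\infty)\Omega_\varphi}$, let $P_\infty$ be the orthogonal projection of $\mathcal H_\varphi$ onto $\mathcal H_\infty$, and let $\mathcal H_0=\{\psi\in\mathcal H_\varphi:\|U^n\psi\|=\|\psi\|=\|U^{*n}\psi\|\ \text{for all } n\in\mathbb N\}$. (i) If $\Phi^n(d_\bot)\to0$ as $n\to\infty$ in the ultrastrong operator topology for all $d_\bot\in\mathfrak D_\infty^{\perp_\varphi}$, then $\mathcal H_\infty=\mathcal H_0$ and $V_+=P_\infty$. (ii) If $\Phi^{\sharp n}(d_\bot)\to0$ as $n\to\infty$ in the ultrastrong operator topology for all $d_\bot\in\mathfrak D_\infty^{\perp_\varphi}$, then $\mathcal H_\infty=\mathcal H_0$ and $V_-=P_\infty$. Here $V_+=\lim_{n\to\infty}U^{*n}U^n$ and $V_-=\lim_{n\to\infty}U^nU^{*n}$ (limits in the strong operator topology, which exist).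
   Context: A unital Schwartz map on a von Neumann algebra $\mathfrak M$ is an ultraweakly continuous linear map $\Phi:\mathfrak M\to\mathfrak M$ with $\Phi(1)=1$ and $0\le\Phi(a^* )\Phi(a)\le\Phi(a^*a)$ for all $a\in\mathfrak M$. A quantum dynamical system $(\mathfrak M,\Phi,\varphi)$ consists of a von Neumann algebra $\mathfrak M$, a unital Schwartz map $\Phi$ on $\mathfrak M$, and a normal faithful state $\varphi$ on $\mathfrak M$ with $\varphi\circ\Phi=\varphi$, such that $\Phi$ admits a $\varphi$-adjoint, i.e. a normal unital Schwartz map $\Phi^\sharp:\mathfrak M\to\mathfrak M$ with $\varphi(b\Phi(a))=\varphi(\Phi^\sharp(b)a)$ for all $a,b\in\mathfrak M$. $U_{\Phi,\varphi}$ is the unique linear contraction on $\mathcal H_\varphi$ with $U_{\Phi,\varphi}\pi_\varphi(a)\Omega_\varphi=\pi_\varphi(\Phi(a))\Omega_\varphi$ for all $a\in\mathfrak M$. For a unital Schwartz map $\Psi$, its multiplicative domain is $\mathfrak D_\Psi=\{a\in\mathfrak M:\Psi(a^*a)=\Psi(a^* )\Psi(a)\text{ and }\Psi(aa^* )=\Psi(a)\Psi(a^* )\}$. For $k\in\mathbb Z$, $\Phi_k=\Phi^k$ if $k\ge0$ and $\Phi_k=(\Phi^\sharp)^{|k|}$ if $k<0$; $\mathfrak D_\infty=\bigcap_{k\in\mathbb Z}\mathfrak D_{\Phi_k}$, and $\mathfrak D_\infty^{\perp_\varphi}=\{a\in\mathfrak M:\varphi(a^*x)=0\text{ for all }x\in\mathfrak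 D_\infty\}$. *)

theory Defs
  imports "HOL-Analysis.Analysis"
begin

section \<open>Complex Hilbert spaces\<close>

class scaleC =
  fixes scaleC :: "complex \<Rightarrow> 'a \<Rightarrow> 'a" (infixr \<open>*\<^sub>C\<close> 75)

class complex_vector = real_vector + scaleC +
  assumes scaleC_add_right: "c *\<^sub>C (x + y) = c *\<^sub>C x + c *\<^sub>C y"
    and scaleC_add_left: "(c + d) *\<^sub>C x = c *\<^sub>C x + d *\<^sub>C x"
    and scaleC_scaleC: "c *\<^sub>C d *\<^sub>C x = (c * d) *\<^sub>C x"
    and scaleC_of_real: "complex_of_real r *\<^sub>C x = r *\<^sub>R x"

text \<open>
  The inner product is conjugate-linear in the first and linear in the second argument.
  As its real part is the inner product of the class \<^class>\<open>real_inner\<close>, it is positive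
  definite and induces the norm; see \<open>cinner_self\<close> below.
\<close>
class complex_inner = complex_vector + real_inner +
  fixes cinner :: "'a \<Rightarrow> 'a \<Rightarrow> complex"
  assumes cinner_commute: "cinner x y = cnj (cinner y x)"
    and cinner_add_right: "cinner x (y + z) = cinner x y + cinner x z"
    and cinner_scaleC_right: "cinner x (c *\<^sub>C y) = c * cinner x y"
    and inner_eq_Re_cinner: "inner x y = Re (cinner x y)"

class chilbert_space = complex_inner + complete_space

lemma cinner_self: "cinner x x = complex_of_real ((norm x)\<^sup>2)"
proof -
  have "Im (cinner x x) = 0"
    using arg_cong[OF cinner_commute[of x x], of Im] by simp
  moreover have "Re (cinner x x) = (norm x)\<^sup>2"
    by (simp add: dot_square_norm flip: inner_eq_Re_cinner)
  ultimately show ?thesis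
    by (simp add: complex_eq_iff)
qed

lemma norm_scaleC: "norm (c *\<^sub>C x) = cmod c * norm (x :: 'a::complex_inner)"
proof -
  have "cinner (c *\<^sub>C x) (c *\<^sub>C x) = c * cnj (c * cinner x x)"
    by (metis cinner_commute cinner_scaleC_right)
  also have "\<dots> = complex_of_real ((cmod c)\<^sup>2 * (norm x)\<^sup>2)"
    by (simp add: cinner_self complex_norm_square del: of_real_power)
  finally have "(norm (c *\<^sub>C x))\<^sup>2 = (cmod c * norm x)\<^sup>2"
    unfolding cinner_self of_real_eq_iff by (simp add: power_mult_distrib)
  then show ?thesis
    by (simp add: power2_eq_iff_nonneg)
qed

instantiation complex :: chilbert_space
begin

definition scaleC_complex :: "complex \<Rightarrow> complex \<Rightarrow> complex"
  where "scaleC_complex c x = c * x"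

definition cinner_complex :: "complex \<Rightarrow> complex \<Rightarrow> complex"
  where "cinner_complex x y = cnj x * y"

instance
  by standard
    (auto simp: scaleC_complex_def cinner_complex_def algebra_simps scaleR_conv_of_real inner_complex_def)

end

instantiation blinfun :: (real_normed_vector, complex_inner) complex_vector
begin

definition scaleC_blinfun :: "complex \<Rightarrow> 'a \<Rightarrow>\<^sub>L 'b \<Rightarrow> 'a \<Rightarrow>\<^sub>L 'b"
  where "scaleC_blinfun c f = Blinfun (\<lambda>x. c *\<^sub>C f x)"

lemma blinfun_apply_scaleC: "blinfun_apply (c *\<^sub>C f) x = c *\<^sub>C f x" for f :: "'a \<Rightarrow>\<^sub>L 'b"
proof -
  have "bounded_linear (\<lambda>y :: 'b. c *\<^sub>C y)"
  proof
    show "c *\<^sub>C (x + y) = c *\<^sub>C x + c *\<^sub>C y" for x y :: 'b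
      by (rule scaleC_add_right)
    show "c *\<^sub>C r *\<^sub>R y = r *\<^sub>R c *\<^sub>C y" for r and y :: 'b
      by (simp add: scaleC_scaleC mult.commute flip: scaleC_of_real)
    show "\<exists>K. \<forall>y :: 'b. norm (c *\<^sub>C y) \<le> norm y * K"
      by (rule exI[of _ "cmod c"]) (simp add: norm_scaleC mult.commute)
  qed
  then have "bounded_linear (\<lambda>x. c *\<^sub>C f x)"
    using bounded_linear_compose blinfun.bounded_linear_right by blast
  then show ?thesis
    unfolding scaleC_blinfun_def by (simp add: bounded_linear_Blinfun_apply)
qed

instance
  by standard
    (auto intro!: blinfun_eqI
      simp: blinfun_apply_scaleC blinfun.add_left blinfun.scaleR_left
        scaleC_add_right scaleC_add_left scaleC_scaleC scaleC_of_real)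

end

definition clinear_on :: "'a::complex_vector set \<Rightarrow> ('a \<Rightarrow> 'b::complex_vector) \<Rightarrow> bool"
  where "clinear_on S f \<longleftrightarrow>
    (\<forall>x\<in>S. \<forall>y\<in>S. f (x + y) = f x + f y) \<and> (\<forall>c. \<forall>x\<in>S. f (c *\<^sub>C x) = c *\<^sub>C f x)"


section \<open>Operators and operator topologies\<close>

text \<open>
  Elements of \<^typ>\<open>'h \<Rightarrow>\<^sub>L 'h\<close> are bounded and real-linear; the bounded operators of the
  complex Hilbert space are the complex-linear ones among them.
\<close>
definition cbounded_ops :: "('h::chilbert_space \<Rightarrow>\<^sub>L 'h) set"
  where "cbounded_ops = {a. clinear_on UNIV (blinfun_apply a)}"

definition cadjoint :: "('h::chilbert_space \<Rightarrow>\<^sub>L 'h) \<Rightarrow> 'h \<Rightarrow>\<^sub>L 'h" (\<open>_\<^sup>\<dagger>\<close> [1000] 999)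
  where "a\<^sup>\<dagger> = (THE b :: 'h \<Rightarrow>\<^sub>L 'h. \<forall>x y. cinner (b x) y = cinner x (a y))"

definition op_le :: "('h::chilbert_space \<Rightarrow>\<^sub>L 'h) \<Rightarrow> ('h \<Rightarrow>\<^sub>L 'h) \<Rightarrow> bool"
  where "op_le a b \<longleftrightarrow> (\<forall>x. cinner x ((b - a) x) \<in> \<real>\<^sub>\<ge>\<^sub>0)"

primrec op_power :: "('h::real_normed_vector \<Rightarrow>\<^sub>L 'h) \<Rightarrow> nat \<Rightarrow> 'h \<Rightarrow>\<^sub>L 'h"
  where
    "op_power a 0 = id_blinfun"
  | "op_power a (Suc n) = a o\<^sub>L op_power a n"

definition seminorm_topology :: "('a::real_vector \<Rightarrow> real) set \<Rightarrow> 'a topology"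
  where "seminorm_topology P = topology_generated_by {{b. p (b - a) < e} | p a e. p \<in> P \<and> 0 < e}"

definition ultraweak_topology :: "('h::chilbert_space \<Rightarrow>\<^sub>L 'h) topology"
  where "ultraweak_topology = seminorm_topology
    {\<lambda>a :: 'h \<Rightarrow>\<^sub>L 'h. cmod (\<Sum>n. cinner (x n) (a (y n))) | (x :: nat \<Rightarrow> 'h) (y :: nat \<Rightarrow> 'h).
      summable (\<lambda>n. (norm (x n))\<^sup>2) \<and> summable (\<lambda>n. (norm (y n))\<^sup>2)}"

definition ultrastrong_topology :: "('h::chilbert_space \<Rightarrow>\<^sub>L 'h) topology"
  where "ultrastrong_topology = seminorm_topology
    {\<lambda>a :: 'h \<Rightarrow>\<^sub>L 'h. sqrt (\<Sum>n. (norm (a (x n)))\<^sup>2) | x :: nat \<Rightarrow> 'h. summable (\<lambda>n. (norm (x n))\<^sup>2)}"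

definition sot_lim :: "(nat \<Rightarrow> 'h::chilbert_space \<Rightarrow>\<^sub>L 'h) \<Rightarrow> 'h \<Rightarrow>\<^sub>L 'h"
  where "sot_lim A = (THE V. limitin strong_operator_topology A V sequentially)"

definition orth_projection :: "'h::chilbert_space set \<Rightarrow> 'h \<Rightarrow>\<^sub>L 'h"
  where "orth_projection S = (THE P :: 'h \<Rightarrow>\<^sub>L 'h. \<forall>x. P x \<in> S \<and> (\<forall>y\<in>S. cinner y (x - P x) = 0))"


section \<open>Von Neumann algebras and quantum dynamical systems\<close>

definition commutant :: "('h::chilbert_space \<Rightarrow>\<^sub>L 'h) set \<Rightarrow> ('h \<Rightarrow>\<^sub>L 'h) set"
  where "commutant S = {b \<in> cbounded_ops. \<forall>a\<in>S. a o\<^sub>L b = b o\<^sub>L a}"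

definition star_subalgebra :: "('h::chilbert_space \<Rightarrow>\<^sub>L 'h) set \<Rightarrow> bool"
  where "star_subalgebra M \<longleftrightarrow>
    M \<subseteq> cbounded_ops \<and> id_blinfun \<in> M \<and>
    (\<forall>a\<in>M. \<forall>b\<in>M. a + b \<in> M \<and> a o\<^sub>L b \<in> M) \<and>
    (\<forall>a\<in>M. a\<^sup>\<dagger> \<in> M \<and> (\<forall>c. c *\<^sub>C a \<in> M))"

definition von_neumann_algebra :: "('h::chilbert_space \<Rightarrow>\<^sub>L 'h) set \<Rightarrow> bool"
  where "von_neumann_algebra M \<longleftrightarrow> star_subalgebra M \<and> commutant (commutant M) = M"

definition unital_schwartz_map ::
    "('h::chilbert_space \<Rightarrow>\<^sub>L 'h) set \<Rightarrow> (('h \<Rightarrow>\<^sub>L 'h) \<Rightarrow> 'h \<Rightarrow>\<^sub>L 'h) \<Rightarrow> bool"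
  where "unital_schwartz_map M \<Phi> \<longleftrightarrow>
    (\<forall>a\<in>M. \<Phi> a \<in> M) \<and> clinear_on M \<Phi> \<and>
    continuous_map (subtopology ultraweak_topology M) (subtopology ultraweak_topology M) \<Phi> \<and>
    \<Phi> id_blinfun = id_blinfun \<and>
    (\<forall>a\<in>M. op_le 0 (\<Phi> (a\<^sup>\<dagger>) o\<^sub>L \<Phi> a) \<and> op_le (\<Phi> (a\<^sup>\<dagger>) o\<^sub>L \<Phi> a) (\<Phi> (a\<^sup>\<dagger> o\<^sub>L a)))"

text \<open>Normality of a state is expressed as ultraweak continuity.\<close>
definition normal_faithful_state ::
    "('h::chilbert_space \<Rightarrow>\<^sub>L 'h) set \<Rightarrow> (('h \<Rightarrow>\<^sub>L 'h) \<Rightarrow> complex) \<Rightarrow> bool"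
  where "normal_faithful_state M \<phi> \<longleftrightarrow>
    clinear_on M \<phi> \<and> (\<forall>a\<in>M. \<phi> (a\<^sup>\<dagger> o\<^sub>L a) \<in> \<real>\<^sub>\<ge>\<^sub>0) \<and> \<phi> id_blinfun = 1 \<and>
    continuous_map (subtopology ultraweak_topology M) euclidean \<phi> \<and>
    (\<forall>a\<in>M. \<phi> (a\<^sup>\<dagger> o\<^sub>L a) = 0 \<longrightarrow> a = 0)"

definition state_adjoint ::
    "('h::chilbert_space \<Rightarrow>\<^sub>L 'h) set \<Rightarrow> (('h \<Rightarrow>\<^sub>L 'h) \<Rightarrow> complex) \<Rightarrow>
     (('h \<Rightarrow>\<^sub>L 'h) \<Rightarrow> 'h \<Rightarrow>\<^sub>L 'h) \<Rightarrow> (('h \<Rightarrow>\<^sub>L 'h) \<Rightarrow> 'h \<Rightarrow>\<^sub>L 'h) \<Rightarrow> bool"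
  where "state_adjoint M \<phi> \<Phi> \<Psi> \<longleftrightarrow>
    unital_schwartz_map M \<Psi> \<and> (\<forall>a\<in>M. \<forall>b\<in>M. \<phi> (b o\<^sub>L \<Phi> a) = \<phi> (\<Psi> b o\<^sub>L a))"

definition quantum_dynamical_system ::
    "('h::chilbert_space \<Rightarrow>\<^sub>L 'h) set \<Rightarrow> (('h \<Rightarrow>\<^sub>L 'h) \<Rightarrow> 'h \<Rightarrow>\<^sub>L 'h) \<Rightarrow>
     (('h \<Rightarrow>\<^sub>L 'h) \<Rightarrow> complex) \<Rightarrow> bool"
  where "quantum_dynamical_system M \<Phi> \<phi> \<longleftrightarrow>
    von_neumann_algebra M \<and> unital_schwartz_map M \<Phi> \<and> normal_faithful_state M \<phi> \<and>
    (\<forall>a\<in>M. \<phi> (\<Phi> a) = \<phi> a) \<and> (\<exists>\<Psi>. state_adjoint M \<phi> \<Phi> \<Psi>)"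


section \<open>GNS representation and multiplicative domains\<close>

text \<open>
  The GNS representation is determined up to unitary equivalence by the following properties;
  results are stated for an arbitrary such triple (with the Hilbert space given by the type \<open>'k\<close>).
\<close>
definition gns_representation ::
    "('h::chilbert_space \<Rightarrow>\<^sub>L 'h) set \<Rightarrow> (('h \<Rightarrow>\<^sub>L 'h) \<Rightarrow> complex) \<Rightarrow>
     (('h \<Rightarrow>\<^sub>L 'h) \<Rightarrow> 'k::chilbert_space \<Rightarrow>\<^sub>L 'k) \<Rightarrow> 'k \<Rightarrow> bool"
  where "gns_representation M \<phi> \<pi> \<Omega> \<longleftrightarrow>
    (\<forall>a\<in>M. \<pi> a \<in> cbounded_ops) \<and> clinear_on M \<pi> \<and> \<pi> id_blinfun = id_blinfun \<and>
    (\<forall>a\<in>M. \<forall>b\<in>M. \<pi> (a o\<^sub>L b) = \<pi> a o\<^sub>L \<pi> b) \<and> (\<forall>a\<in>M. \<pi> (a\<^sup>\<dagger>) = (\<pi> a)\<^sup>\<dagger>) \<and>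
    closure ((\<lambda>a. \<pi> a \<Omega>) ` M) = UNIV \<and>
    (\<forall>a\<in>M. \<phi> a = cinner \<Omega> (\<pi> a \<Omega>))"

definition gns_contraction ::
    "('h::chilbert_space \<Rightarrow>\<^sub>L 'h) set \<Rightarrow> (('h \<Rightarrow>\<^sub>L 'h) \<Rightarrow> 'h \<Rightarrow>\<^sub>L 'h) \<Rightarrow>
     (('h \<Rightarrow>\<^sub>L 'h) \<Rightarrow> 'k::chilbert_space \<Rightarrow>\<^sub>L 'k) \<Rightarrow> 'k \<Rightarrow> 'k \<Rightarrow>\<^sub>L 'k"
  where "gns_contraction M \<Phi> \<pi> \<Omega> =
    (THE U. U \<in> cbounded_ops \<and> norm U \<le> 1 \<and> (\<forall>a\<in>M. U (\<pi> a \<Omega>) = \<pi> (\<Phi> a) \<Omega>))"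

definition mult_domain ::
    "('h::chilbert_space \<Rightarrow>\<^sub>L 'h) set \<Rightarrow> (('h \<Rightarrow>\<^sub>L 'h) \<Rightarrow> 'h \<Rightarrow>\<^sub>L 'h) \<Rightarrow> ('h \<Rightarrow>\<^sub>L 'h) set"
  where "mult_domain M \<Psi> =
    {a \<in> M. \<Psi> (a\<^sup>\<dagger> o\<^sub>L a) = \<Psi> (a\<^sup>\<dagger>) o\<^sub>L \<Psi> a \<and> \<Psi> (a o\<^sub>L a\<^sup>\<dagger>) = \<Psi> a o\<^sub>L \<Psi> (a\<^sup>\<dagger>)}"

definition int_iterate :: "('a \<Rightarrow> 'a) \<Rightarrow> ('a \<Rightarrow> 'a) \<Rightarrow> int \<Rightarrow> 'a \<Rightarrow> 'a"
  where "int_iterate \<Phi> \<Psi> k = (if 0 \<le> k then \<Phi> ^^ nat k else \<Psi> ^^ nat \<bar>k\<bar>)"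

definition D_infinity ::
    "('h::chilbert_space \<Rightarrow>\<^sub>L 'h) set \<Rightarrow> (('h \<Rightarrow>\<^sub>L 'h) \<Rightarrow> 'h \<Rightarrow>\<^sub>L 'h) \<Rightarrow>
     (('h \<Rightarrow>\<^sub>L 'h) \<Rightarrow> 'h \<Rightarrow>\<^sub>L 'h) \<Rightarrow> ('h \<Rightarrow>\<^sub>L 'h) set"
  where "D_infinity M \<Phi> \<Psi> = (\<Inter>k::int. mult_domain M (int_iterate \<Phi> \<Psi> k))"

definition state_perp ::
    "('h::chilbert_space \<Rightarrow>\<^sub>L 'h) set \<Rightarrow> (('h \<Rightarrow>\<^sub>L 'h) \<Rightarrow> complex) \<Rightarrow> ('h \<Rightarrow>\<^sub>L 'h) set \<Rightarrow> ('h \<Rightarrow>\<^sub>L 'h) set"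
  where "state_perp M \<phi> D = {a \<in> M. \<forall>x\<in>D. \<phi> (a\<^sup>\<dagger> o\<^sub>L x) = 0}"

definition H_zero :: "('k::chilbert_space \<Rightarrow>\<^sub>L 'k) \<Rightarrow> 'k set"
  where "H_zero U =
    {\<psi>. \<forall>n. norm (op_power U n \<psi>) = norm \<psi> \<and> norm \<psi> = norm (op_power (U\<^sup>\<dagger>) n \<psi>)}"

definition V_plus_seq :: "('k::chilbert_space \<Rightarrow>\<^sub>L 'k) \<Rightarrow> nat \<Rightarrow> 'k \<Rightarrow>\<^sub>L 'k"
  where "V_plus_seq U n = op_power (U\<^sup>\<dagger>) n o\<^sub>L op_power U n"

definition V_minus_seq :: "('k::chilbert_space \<Rightarrow>\<^sub>L 'k) \<Rightarrow> nat \<Rightarrow> 'k \<Rightarrow>\<^sub>L 'k"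
  where "V_minus_seq U n = op_power U n o\<^sub>L op_power (U\<^sup>\<dagger>) n"

end

theory Submission
  imports Defs
begin

text \<open>
  The limits \<open>V\<^sub>+ = lim U\<^sup>*\<^sup>n U\<^sup>n\<close> and \<open>V\<^sub>- = lim U\<^sup>n U\<^sup>*\<^sup>n\<close> exist by monotonicity, and \<open>\<H>\<^sub>0\<close> is
  their common fixed space, so the powers of \<open>B = V\<^sub>+ V\<^sub>- V\<^sub>+\<close> converge strongly to the orthogonal
  projection \<open>P\<close> onto \<open>\<H>\<^sub>0\<close>. Both \<open>U\<close> and \<open>U\<^sup>*\<close> map vectors \<open>\<pi>(a)\<Omega>\<close> to vectors of the same form without
  increasing the norm of \<open>a\<close>. By weak operator compactness of balls and normality of \<open>\<phi>\<close> this
  property survives strong limits, hence holds for \<open>P\<close>. If \<open>P \<pi>(a)\<Omega> = \<pi>(b)\<Omega>\<close>, faithfulness of \<open>\<phi>\<close>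
  turns the norm equalities that define \<open>\<H>\<^sub>0\<close> into \<open>b \<in> \<DD>\<^sub>\<infinity>\<close>; thus \<open>a \<mapsto> b\<close> is a conditional
  expectation onto \<open>\<DD>\<^sub>\<infinity>\<close>, obtained without modular theory. Therefore \<open>\<H>\<^sub>\<infinity> = \<H>\<^sub>0\<close> in any case, and
  the vectors \<open>\<pi>(a - b)\<Omega>\<close> with \<open>a - b \<in> \<DD>\<^sub>\<infinity>\<^sup>\<bottom>\<close> are dense in the orthogonal complement of \<open>\<H>\<^sub>\<infinity>\<close>.
  Ultrastrong decay on \<open>\<DD>\<^sub>\<infinity>\<^sup>\<bottom>\<close> makes \<open>U\<^sup>n\<close>, and with it \<open>V\<^sub>+\<close>, vanish on this complement.
\<close>

section \<open>Complex Hilbert spaces and adjoints\<close>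

lemma cinner_add_left: "cinner (x + y) z = cinner x z + cinner y (z :: 'a::complex_inner)"
  by (metis cinner_add_right cinner_commute complex_cnj_add)

lemma cinner_scaleC_left: "cinner (c *\<^sub>C x) y = cnj c * cinner x (y :: 'a::complex_inner)"
  by (metis cinner_commute cinner_scaleC_right complex_cnj_mult)

lemma Im_cinner: "Im (cinner x y) = inner (\<i> *\<^sub>C x) (y :: 'a::complex_inner)"
  by (simp add: inner_eq_Re_cinner cinner_scaleC_left)

lemma cinner_conv_inner: "cinner x y = Complex (inner x y) (inner (\<i> *\<^sub>C x) (y :: 'a::complex_inner))"
  by (simp add: complex_eq_iff Im_cinner inner_eq_Re_cinner)

lemma norm_cinner_le: "cmod (cinner x y) \<le> norm x * norm (y :: 'a::complex_inner)"
proof (cases "cinner x y = 0")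
  case False
  \<comment> \<open>Multiplying by this phase rotates the inner product onto the nonnegative real
    axis, where the real Cauchy-Schwarz inequality applies.\<close>
  define c where "c = cnj (sgn (cinner x y))"
  have c: "cmod c = 1" using False by (simp add: c_def norm_sgn)
  have "c * cinner x y = cmod (cinner x y)"
    using False by (simp add: c_def sgn_eq complex_norm_square[symmetric] power2_eq_square field_simps)
  then have "cmod (cinner x y) = inner x (c *\<^sub>C y)"
    by (simp add: inner_eq_Re_cinner cinner_scaleC_right)
  also have "\<dots> \<le> norm x * norm (c *\<^sub>C y)"
    by (rule norm_cauchy_schwarz)
  finally show ?thesis by (simp add: norm_scaleC c)
qed simp

lemma bounded_bilinear_cinner: "bounded_bilinear (cinner :: 'a::complex_inner \<Rightarrow> 'a \<Rightarrow> complex)"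
proof
  fix a a' b b' :: 'a and r :: real
  show "cinner (a + a') b = cinner a b + cinner a' b" by (rule cinner_add_left)
  show "cinner a (b + b') = cinner a b + cinner a b'" by (rule cinner_add_right)
  show "cinner (r *\<^sub>R a) b = r *\<^sub>R cinner a b"
    by (simp add: scaleC_of_real[symmetric] cinner_scaleC_left scaleR_conv_of_real scaleC_complex_def)
  show "cinner a (r *\<^sub>R b) = r *\<^sub>R cinner a b"
    by (simp add: scaleC_of_real[symmetric] cinner_scaleC_right scaleR_conv_of_real scaleC_complex_def)
  show "\<exists>K. \<forall>a b :: 'a. norm (cinner a b) \<le> norm a * norm b * K"
    by (rule exI[of _ 1]) (simp add: norm_cinner_le)
qed

interpretation cinner: bounded_bilinear "cinner :: 'a::complex_inner \<Rightarrow> 'a \<Rightarrow> complex"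
  by (rule bounded_bilinear_cinner)

lemma bounded_linear_scaleC: "bounded_linear (\<lambda>x :: 'a::complex_inner. c *\<^sub>C x)"
  by (rule bounded_linear_intro[where K = "cmod c"])
    (simp_all add: scaleC_add_right norm_scaleC scaleC_scaleC mult.commute flip: scaleC_of_real)

lemma cinner_ext: "(\<And>y. cinner y x = cinner y z) \<Longrightarrow> x = (z :: 'a::complex_inner)"
  using cinner.diff_right[of "x - z" x z] cinner_self[of "x - z"] by simp

text \<open>Minimising \<open>norm x ^ 2 - 2 * f x\<close> yields both the Riesz representation (\<open>S = UNIV\<close>)
  and orthogonal projections (\<open>f = inner x\<close>).\<close>
lemma representation_on_closed_subspace:
  fixes S :: "'a::{real_inner, complete_space} set" and f :: "'a \<Rightarrow> real"
  assumes S: "subspace S" "closed S" and f: "bounded_linear f"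
  shows "\<exists>z\<in>S. \<forall>x\<in>S. f x = inner z x"
proof -
  interpret f: bounded_linear f by (rule f)
  define J where "J x = inner x x - 2 * f x" for x
  obtain K where K: "\<And>x. norm (f x) \<le> norm x * K" using f.bounded by blast
  have Jlb: "J x \<ge> - (K\<^sup>2)" for x
  proof -
    have "2 * f x \<le> 2 * (norm x * K)" using K[of x] by auto
    also have "\<dots> \<le> (norm x)\<^sup>2 + K\<^sup>2" using sum_squares_bound[of "norm x" K] by simp
    finally show ?thesis by (simp add: J_def dot_square_norm)
  qed
  define m where "m = Inf (J ` S)"
  have bdd: "bdd_below (J ` S)" using Jlb by (intro bdd_belowI[of _ "- (K\<^sup>2)"]) auto
  have S0: "0 \<in> S" using S by (simp add: subspace_0)
  have m_le: "m \<le> J x" if "x \<in> S" for x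
    unfolding m_def using bdd that by (intro cInf_lower) auto
  have "\<exists>x\<in>S. J x < m + 1 / Suc n" for n
    using cInf_lessD[of "J ` S" "m + 1 / Suc n"] S0 by (auto simp: m_def)
  then obtain x where xS: "\<And>n. x n \<in> S" and xm: "\<And>n. J (x n) < m + 1 / Suc n" by metis
  \<comment> \<open>The linear part of \<open>J\<close> cancels in the parallelogram identity, so
    near-minimisers are close to each other: the value at their midpoint is at least
    \<open>m\<close>.\<close>
  have par: "(norm (a - b))\<^sup>2 = 2 * J a + 2 * J b - 4 * J ((1/2) *\<^sub>R (a + b))" for a b
    by (simp add: J_def dot_square_norm[symmetric] inner_simps f.add f.scaleR inner_commute algebra_simps)
  have cau: "(norm (x i - x j))\<^sup>2 \<le> 2 / Suc i + 2 / Suc j" for i j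
  proof -
    have "m \<le> J ((1/2) *\<^sub>R (x i + x j))"
      using S xS by (intro m_le) (simp add: subspace_add subspace_mul)
    then show ?thesis using xm[of i] xm[of j] par[of "x i" "x j"] by simp
  qed
  have "Cauchy x"
  proof (rule metric_CauchyI)
    fix e :: real assume e: "e > 0"
    obtain N where N: "inverse (real (Suc N)) < e\<^sup>2 / 4"
      using reals_Archimedean[of "e\<^sup>2/4"] e by auto
    have *: "dist (x i) (x j) < e" if "i \<ge> N" "j \<ge> N" for i j
    proof -
      have "2 / Suc k \<le> 2 * inverse (real (Suc N))" if "k \<ge> N" for k
        using that by (simp add: field_simps)
      from this[OF that(1)] this[OF that(2)] cau[of i j] N have "(norm (x i - x j))\<^sup>2 < e\<^sup>2" by linarith
      then show ?thesis using e by (simp add: dist_norm power2_less_imp_less)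
    qed
    then show "\<exists>N. \<forall>i\<ge>N. \<forall>j\<ge>N. dist (x i) (x j) < e" by blast
  qed
  then obtain z where z: "x \<longlonglongrightarrow> z" using Cauchy_convergent convergent_def by blast
  have zS: "z \<in> S" using closed_sequentially[OF S(2) _ z] xS by blast
  have "(\<lambda>n. J (x n)) \<longlonglongrightarrow> J z"
    unfolding J_def by (intro tendsto_intros z f.tendsto)
  moreover have "(\<lambda>n. m + 1 / real (Suc n)) \<longlonglongrightarrow> m + 0"
    by (intro tendsto_intros LIMSEQ_Suc[OF lim_1_over_n])
  ultimately have Jz: "J z \<le> m"
    using xm by (intro LIMSEQ_le[where X = "\<lambda>n. J (x n)" and Y = "\<lambda>n. m + 1 / real (Suc n)"]) (auto intro: less_imp_le)
  have "f y = inner z y" if y: "y \<in> S" for y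
  proof (rule ccontr)
    define d where "d = f y - inner z y"
    assume "f y \<noteq> inner z y"
    then have d: "d \<noteq> 0" by (simp add: d_def)
    have y0: "inner y y > 0" using d by (auto simp: d_def f.zero)
    have "J z \<le> J (z + t *\<^sub>R y)" for t
      using Jz m_le[of "z + t *\<^sub>R y"] S zS y by (force simp: subspace_add subspace_mul)
    then have "0 \<le> t\<^sup>2 * inner y y - 2 * t * d" for t
      by (simp add: J_def d_def inner_simps f.add f.scaleR inner_commute power2_eq_square algebra_simps)
    \<comment> \<open>This \<open>t\<close> minimises the quadratic on the right, whose minimum is
      negative as \<open>d\<close> is nonzero.\<close>
    from this[of "d / inner y y"] have "0 \<le> - (d\<^sup>2 / inner y y)"
      using y0 by (simp add: power2_eq_square field_simps)
    moreover have "d\<^sup>2 / inner y y > 0" using d y0 by simp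
    ultimately show False by linarith
  qed
  then show ?thesis using zS by blast
qed

text \<open>For fixed \<open>y\<close> the Riesz vector of the first argument serves as
  \<open>b y\<close>; its uniqueness gives linearity, and testing with \<open>x = b y\<close> gives
  the bound. This produces adjoints and, later, the operator belonging to a limit of matrix
  coefficients.\<close>

lemma bounded_form_represented:
  fixes B :: "'a::{real_inner, complete_space} \<Rightarrow> 'b::real_normed_vector \<Rightarrow> real"
  assumes B: "bounded_bilinear B"
  obtains b :: "'b \<Rightarrow>\<^sub>L 'a" where "\<And>x y. inner x (b y) = B x y"
proof -
  interpret B: bounded_bilinear B by (rule B)
  obtain C where C0: "0 \<le> C" and C: "\<And>x y. norm (B x y) \<le> norm x * norm y * C"
    using B.nonneg_bounded by blast
  have "\<exists>z. \<forall>x. B x y = inner z x" for y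
    using representation_on_closed_subspace[OF subspace_UNIV closed_UNIV B.bounded_linear_left] by simp
  then obtain b where b: "\<And>x y. B x y = inner (b y) x" by metis
  have ext: "u = v" if "\<And>x. inner u x = inner v x" for u v :: 'a
    using that[of "u - v"] inner_diff_left[of u v "u - v"] by simp
  have "bounded_linear b"
  proof (rule bounded_linear_intro)
    show "b (x + y) = b x + b y" for x y
      by (rule ext) (simp add: b[symmetric] B.add_right inner_add_left)
    show "b (r *\<^sub>R x) = r *\<^sub>R b x" for x r
      by (rule ext) (simp add: b[symmetric] B.scaleR_right)
    show "norm (b x) \<le> norm x * C" for x
    proof (cases "b x = 0")
      case False
      have "(norm (b x))\<^sup>2 \<le> norm (b x) * norm x * C"
        using C[of "b x" x] by (simp add: b dot_square_norm)
      then show ?thesis using False by (simp add: power2_eq_square mult.assoc)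
    qed (use C0 in simp)
  qed
  then have "inner x (Blinfun b y) = B x y" for x y
    by (simp add: bounded_linear_Blinfun_apply b inner_commute)
  then show thesis by (rule that)
qed

section \<open>Complex-linear operators and their adjoints\<close>

lemma cbounded_opsD:
  assumes "a \<in> cbounded_ops"
  shows "blinfun_apply a (c *\<^sub>C x) = c *\<^sub>C a x"
  using assms by (simp add: cbounded_ops_def clinear_on_def)

lemma cbounded_opsI: "(\<And>c x. blinfun_apply a (c *\<^sub>C x) = c *\<^sub>C a x) \<Longrightarrow> a \<in> cbounded_ops"
  by (simp add: cbounded_ops_def clinear_on_def blinfun.add_right)

text \<open>The Riesz argument is real; this lifts its identities to the complex inner product,
  whose imaginary part is a real inner product with first argument multiplied by the imaginary
  unit.\<close>

lemma cinner_eq_if_inner_eq: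
  fixes x y x' y' :: "'a::complex_inner"
  assumes "inner x y = inner x' y'" "inner (\<i> *\<^sub>C x) y = inner (\<i> *\<^sub>C x') y'"
  shows "cinner x y = cinner x' y'"
  using assms by (simp add: cinner_conv_inner)

lemma cinner_eq_swap: "cinner x y = cinner x' y' \<Longrightarrow> cinner y x = cinner y' (x' :: 'a::complex_inner)"
  by (simp add: cinner_commute[of y x] cinner_commute[of y' x'])

lemma cadjoint_unique:
  fixes a b :: "'h::chilbert_space \<Rightarrow>\<^sub>L 'h"
  assumes "\<And>x y. cinner (b x) y = cinner x (a y)"
  shows "a\<^sup>\<dagger> = b"
  unfolding cadjoint_def
proof (rule the_equality)
  fix b' :: "'h \<Rightarrow>\<^sub>L 'h"
  assume b': "\<forall>x y. cinner (b' x) y = cinner x (a y)"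
  show "b' = b"
  proof (rule blinfun_eqI, rule cinner_ext)
    show "cinner y (b' x) = cinner y (b x)" for x y
      by (rule cinner_eq_swap) (simp add: assms b')
  qed
qed (use assms in auto)

text \<open>Existence of the adjoint: the real adjoint obtained from the form
  \<open>inner (a x) y\<close> is already the complex one, because \<open>a\<close> commutes with
  multiplication by the imaginary unit.\<close>

lemma cinner_cadjoint_left:
  assumes a: "a \<in> cbounded_ops"
  shows "cinner ((a\<^sup>\<dagger>) x) y = cinner x (blinfun_apply a y)"
proof -
  have "bounded_bilinear (\<lambda>x y. inner (a x) y)"
    by (rule bounded_bilinear.comp1[OF bounded_bilinear_inner blinfun.bounded_linear_right])
  then obtain b :: "'a \<Rightarrow>\<^sub>L 'a" where b: "\<And>x y. inner x (b y) = inner (a x) y"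
    using bounded_form_represented[of "\<lambda>x y. inner (a x) y"] by blast
  have "cinner x (b y) = cinner (a x) y" for x y
    by (rule cinner_eq_if_inner_eq) (simp_all add: b cbounded_opsD[OF a])
  then have b': "cinner (b x) y = cinner x (a y)" for x y
    by (rule cinner_eq_swap)
  show ?thesis by (simp add: cadjoint_unique[of b a, OF b'] b')
qed

lemma cinner_cadjoint_right:
  assumes "a \<in> cbounded_ops"
  shows "cinner x ((a\<^sup>\<dagger>) y) = cinner (blinfun_apply a x) y"
  by (rule cinner_eq_swap) (rule cinner_cadjoint_left[OF assms])

lemma cadjoint_in_cbounded_ops: "a \<in> cbounded_ops \<Longrightarrow> a\<^sup>\<dagger> \<in> cbounded_ops"
  by (rule cbounded_opsI, rule cinner_ext) (simp add: cinner_cadjoint_right cinner_scaleC_right)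

lemma cadjoint_cadjoint: "a \<in> cbounded_ops \<Longrightarrow> (a\<^sup>\<dagger>)\<^sup>\<dagger> = a"
  by (rule cadjoint_unique) (simp add: cinner_cadjoint_right)

lemma norm_cadjoint_le:
  assumes a: "a \<in> cbounded_ops"
  shows "norm (a\<^sup>\<dagger>) \<le> norm a"
proof (rule norm_blinfun_bound)
  fix x
  have "(norm ((a\<^sup>\<dagger>) x))\<^sup>2 = cmod (cinner ((a\<^sup>\<dagger>) x) ((a\<^sup>\<dagger>) x))"
    by (simp add: cinner_self norm_power)
  also have "\<dots> = cmod (cinner x (a ((a\<^sup>\<dagger>) x)))"
    by (simp add: cinner_cadjoint_left a)
  also have "\<dots> \<le> norm x * (norm a * norm ((a\<^sup>\<dagger>) x))"
    by (meson mult_left_mono norm_blinfun norm_cinner_le norm_ge_zero order.trans)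
  finally have "norm ((a\<^sup>\<dagger>) x) * norm ((a\<^sup>\<dagger>) x) \<le> (norm a * norm x) * norm ((a\<^sup>\<dagger>) x)"
    by (simp add: power2_eq_square mult_ac)
  then show "norm ((a\<^sup>\<dagger>) x) \<le> norm a * norm x"
    by (cases "(a\<^sup>\<dagger>) x = 0") auto
qed simp

lemma norm_cadjoint: "a \<in> cbounded_ops \<Longrightarrow> norm (a\<^sup>\<dagger>) = norm a"
  by (metis cadjoint_cadjoint cadjoint_in_cbounded_ops norm_cadjoint_le order.antisym)

lemma cadjoint_add:
  "a \<in> cbounded_ops \<Longrightarrow> b \<in> cbounded_ops \<Longrightarrow> (a + b)\<^sup>\<dagger> = a\<^sup>\<dagger> + b\<^sup>\<dagger>"
  by (rule cadjoint_unique) (simp add: cinner_cadjoint_left blinfun.add_left cinner_add_left cinner_add_right)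

lemma cadjoint_diff:
  "a \<in> cbounded_ops \<Longrightarrow> b \<in> cbounded_ops \<Longrightarrow> (a - b)\<^sup>\<dagger> = a\<^sup>\<dagger> - b\<^sup>\<dagger>"
  by (rule cadjoint_unique) (simp add: cinner_cadjoint_left blinfun.diff_left cinner.diff_left cinner.diff_right)

lemma cadjoint_scaleC:
  "a \<in> cbounded_ops \<Longrightarrow> (c *\<^sub>C a)\<^sup>\<dagger> = cnj c *\<^sub>C a\<^sup>\<dagger>"
  by (rule cadjoint_unique)
    (simp add: cinner_cadjoint_left blinfun_apply_scaleC cinner_scaleC_left cinner_scaleC_right)

lemma cadjoint_id: "(id_blinfun :: 'h::chilbert_space \<Rightarrow>\<^sub>L 'h)\<^sup>\<dagger> = id_blinfun"
  by (rule cadjoint_unique) simp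

text \<open>Symmetry for the real inner product is the form of self-adjointness that is visibly norm
  closed and that the real norm estimates below take as hypothesis.\<close>

lemma selfadjoint_iff_inner:
  fixes a :: "'h::chilbert_space \<Rightarrow>\<^sub>L 'h"
  assumes a: "a \<in> cbounded_ops"
  shows "a\<^sup>\<dagger> = a \<longleftrightarrow> (\<forall>x y. inner (a x) y = inner x (a y))"
proof
  assume "a\<^sup>\<dagger> = a"
  then show "\<forall>x y. inner (a x) y = inner x (a y)"
    by (metis a cinner_cadjoint_left inner_eq_Re_cinner)
next
  assume sym: "\<forall>x y. inner (a x) y = inner x (a y)"
  show "a\<^sup>\<dagger> = a"
    by (rule cadjoint_unique, rule cinner_eq_if_inner_eq)
      (use sym in \<open>simp_all add: cbounded_opsD[OF a, symmetric]\<close>)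
qed

section \<open>Positivity in operator algebras\<close>

instance chilbert_space \<subseteq> banach ..

text \<open>For \<open>0 <= B <= 1\<close> the difference \<open>B - B^2\<close> equals
  \<open>(1 - B) B (1 - B) + B (1 - B) B\<close>, a sum of two positive operators. This replaces
  square roots of operators in many places.\<close>

lemma norm_apply_sq_le_quadratic_form:
  fixes B :: "'a::real_inner \<Rightarrow>\<^sub>L 'a"
  assumes sym: "\<And>x y. inner (B x) y = inner x (B y)"
    and nonneg: "\<And>x. 0 \<le> inner x (B x)" and le1: "\<And>x. inner x (B x) \<le> inner x x"
  shows "(norm (B x))\<^sup>2 \<le> inner x (B x)"
proof -
  have "0 \<le> inner (x - B x) (B (x - B x)) + (inner (B x) (B x) - inner (B x) (B (B x)))"
    using nonneg[of "x - B x"] le1[of "B x"] by simp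
  also have "\<dots> = inner x (B x) - inner (B x) (B x)"
    by (simp add: inner_simps blinfun.diff_right sym inner_commute)
  finally show ?thesis by (simp add: dot_square_norm)
qed

text \<open>Polarisation expresses \<open>inner y (B x)\<close> by the quadratic form at
  \<open>x + y\<close> and \<open>x - y\<close>; choosing \<open>y\<close> parallel to
  \<open>B x\<close> recovers the norm of \<open>B x\<close>.\<close>

lemma norm_symmetric_le:
  fixes B :: "'a::real_inner \<Rightarrow>\<^sub>L 'a"
  assumes sym: "\<And>x y. inner (B x) y = inner x (B y)"
    and bound: "\<And>x. \<bar>inner x (B x)\<bar> \<le> k * inner x x" and k: "0 \<le> k"
  shows "norm B \<le> k"
proof (rule norm_blinfun_bound[OF k])
  fix x
  show "norm (B x) \<le> k * norm x"
  proof (cases "B x = 0 \<or> x = 0")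
    case False
    \<comment> \<open>With \<open>y\<close> as long as \<open>x\<close>, the parallelogram law
      bounds the polarised expression by exactly \<open>4 * k * inner x x\<close>.\<close>
    define y where "y = (norm x / norm (B x)) *\<^sub>R B x"
    have ny: "inner y y = inner x x" using False by (simp add: y_def dot_square_norm)
    have "4 * inner y (B x) = inner (x + y) (B (x + y)) - inner (x - y) (B (x - y))"
      using sym[of x y] by (simp add: inner_simps blinfun.diff_right blinfun.add_right inner_commute)
    also have "\<dots> \<le> k * inner (x + y) (x + y) + k * inner (x - y) (x - y)"
      using bound[of "x + y"] bound[of "x - y"] by linarith
    also have "\<dots> = 4 * (k * inner x x)"
      by (simp add: inner_simps ny algebra_simps)
    finally have "inner y (B x) \<le> k * inner x x" by simp
    moreover have "inner y (B x) = norm x * norm (B x)"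
      using False by (simp add: y_def dot_square_norm power2_eq_square)
    ultimately show ?thesis using False by (simp add: dot_square_norm power2_eq_square)
  qed (use k in auto)
qed

text \<open>Reality of the form at \<open>x + y\<close> makes the imaginary parts of the two mixed
  terms cancel, and reality at \<open>x + \<i> *\<^sub>C y\<close> makes their real parts agree;
  hence the mixed terms are conjugate to each other.\<close>

lemma selfadjoint_if_real_quadratic_form:
  fixes p :: "'h::chilbert_space \<Rightarrow>\<^sub>L 'h"
  assumes p: "p \<in> cbounded_ops" and re: "\<And>x. cinner x (p x) \<in> \<real>"
  shows "p\<^sup>\<dagger> = p"
proof (rule cadjoint_unique)
  fix x y
  have 1: "Im (cinner x (p y)) + Im (cinner y (p x)) = 0"
    using re[of "x + y"] re[of x] re[of y]
    by (simp add: blinfun.add_right cinner_add_left cinner_add_right complex_is_Real_iff)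
  have 2: "Re (cinner x (p y)) = Re (cinner y (p x))"
    using re[of "x + \<i> *\<^sub>C y"] re[of x] re[of y]
    by (simp add: blinfun.add_right cinner_add_left cinner_add_right complex_is_Real_iff
        cbounded_opsD[OF p] cinner_scaleC_left cinner_scaleC_right)
  show "cinner (p x) y = cinner x (p y)"
    using 1 2 by (subst cinner_commute) (simp add: complex_eq_iff)
qed

lemma scaleC_minus_one: "(- 1) *\<^sub>C x = - (x :: 'a::complex_vector)"
  using scaleC_of_real[of "- 1" x] by simp

lemma scaleC_minus_right: "c *\<^sub>C (- x) = (- c) *\<^sub>C (x :: 'a::complex_vector)"
  using scaleC_scaleC[of c "- 1" x] by (simp add: scaleC_minus_one)

section \<open>Star-subalgebras, norm closedness and square roots\<close>

lemma star_subalgebra_cbounded: "star_subalgebra M \<Longrightarrow> a \<in> M \<Longrightarrow> a \<in> cbounded_ops"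
  unfolding star_subalgebra_def by blast

lemma star_subalgebra_id: "star_subalgebra M \<Longrightarrow> id_blinfun \<in> M"
  unfolding star_subalgebra_def by blast

lemma star_subalgebra_closed:
  assumes M: "star_subalgebra M"
  shows "a \<in> M \<Longrightarrow> a\<^sup>\<dagger> \<in> M" "a \<in> M \<Longrightarrow> c *\<^sub>C a \<in> M" "a \<in> M \<Longrightarrow> r *\<^sub>R a \<in> M"
    "a \<in> M \<Longrightarrow> b \<in> M \<Longrightarrow> a + b \<in> M" "a \<in> M \<Longrightarrow> b \<in> M \<Longrightarrow> a o\<^sub>L b \<in> M"
    "a \<in> M \<Longrightarrow> b \<in> M \<Longrightarrow> a - b \<in> M"
proof -
  have c: "c *\<^sub>C a \<in> M" if "a \<in> M" for a c using M that unfolding star_subalgebra_def by blast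
  then show "a \<in> M \<Longrightarrow> c *\<^sub>C a \<in> M" .
  have add: "a + b \<in> M" if "a \<in> M" "b \<in> M" for a b using M that unfolding star_subalgebra_def by blast
  then show "a \<in> M \<Longrightarrow> b \<in> M \<Longrightarrow> a + b \<in> M" .
  show "a \<in> M \<Longrightarrow> a\<^sup>\<dagger> \<in> M" "a \<in> M \<Longrightarrow> b \<in> M \<Longrightarrow> a o\<^sub>L b \<in> M"
    using M unfolding star_subalgebra_def by blast+
  show "r *\<^sub>R a \<in> M" if "a \<in> M"
    using c[OF that, of "complex_of_real r"] by (simp add: scaleC_of_real)
  show "a - b \<in> M" if "a \<in> M" "b \<in> M"
    using add[OF that(1) c[OF that(2), of "- 1"]] by (simp add: scaleC_minus_one)
qed

lemma clinear_onD:
  assumes "clinear_on S f" "x \<in> S"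
  shows "y \<in> S \<Longrightarrow> f (x + y) = f x + f y" "f (c *\<^sub>C x) = c *\<^sub>C f x"
    "f (r *\<^sub>R x) = r *\<^sub>R f x"
    "y \<in> S \<Longrightarrow> (- 1) *\<^sub>C y \<in> S \<Longrightarrow> f (x - y) = f x - f y"
proof -
  show "y \<in> S \<Longrightarrow> f (x + y) = f x + f y" and c: "f (c *\<^sub>C x) = c *\<^sub>C f x" for c
    using assms by (auto simp: clinear_on_def)
  show "f (r *\<^sub>R x) = r *\<^sub>R f x" using c[of "complex_of_real r"] by (simp add: scaleC_of_real)
  assume "y \<in> S" "(- 1) *\<^sub>C y \<in> S"
  then have "f (x + (- 1) *\<^sub>C y) = f x + (- 1) *\<^sub>C f y"
    using assms unfolding clinear_on_def by metis
  then show "f (x - y) = f x - f y" by (simp add: scaleC_minus_one)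
qed

lemma closed_cbounded_ops: "closed (cbounded_ops :: ('h::chilbert_space \<Rightarrow>\<^sub>L 'h) set)"
proof -
  have "continuous_on UNIV (\<lambda>a :: 'h \<Rightarrow>\<^sub>L 'h. c *\<^sub>C a x)" for c x
    by (rule bounded_linear.continuous_on[OF bounded_linear_scaleC]) (intro continuous_intros)
  then have "closed {a :: 'h \<Rightarrow>\<^sub>L 'h. \<forall>c x. a (c *\<^sub>C x) = c *\<^sub>C a x}"
    by (intro closed_Collect_all closed_Collect_eq continuous_intros) auto
  moreover have "cbounded_ops = {a :: 'h \<Rightarrow>\<^sub>L 'h. \<forall>c x. a (c *\<^sub>C x) = c *\<^sub>C a x}"
    using cbounded_opsD cbounded_opsI by blast
  ultimately show ?thesis by simp
qed

lemma closed_commutant: "closed (commutant S)"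
proof -
  have "closed {b. a o\<^sub>L b = b o\<^sub>L a}" for a :: "'a \<Rightarrow>\<^sub>L 'a"
    by (intro closed_Collect_eq bounded_bilinear.continuous_on[OF bounded_bilinear_blinfun_compose] continuous_intros)
  then have "closed (cbounded_ops \<inter> (\<Inter>a\<in>S. {b. a o\<^sub>L b = b o\<^sub>L a}))"
    by (intro closed_Int closed_INT ballI closed_cbounded_ops)
  moreover have "commutant S = cbounded_ops \<inter> (\<Inter>a\<in>S. {b. a o\<^sub>L b = b o\<^sub>L a})"
    by (auto simp: commutant_def)
  ultimately show ?thesis by simp
qed

text \<open>A bicommutant is a commutant, hence norm closed. Norm closedness is what the fixed point
  construction of square roots consumes.\<close>

lemma von_neumann_algebraD:
  assumes "von_neumann_algebra M"
  shows "star_subalgebra M" "closed M"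
  using assms closed_commutant[of "commutant M"] by (auto simp: von_neumann_algebra_def)

lemma norm_blinfun_compose_le_mult:
  "norm a \<le> r \<Longrightarrow> norm b \<le> s \<Longrightarrow> norm (a o\<^sub>L b) \<le> r * s"
  by (meson mult_mono norm_blinfun_compose norm_ge_zero order.trans)

text \<open>If \<open>y\<close> is a fixed point of \<open>y \<mapsto> (x + y\<^sup>2) / 2\<close>, then \<open>1 - y\<close> is a square root of \<open>1 - x\<close>.\<close>
lemma square_root_id_minus:
  fixes x :: "'h::chilbert_space \<Rightarrow>\<^sub>L 'h"
  assumes M: "star_subalgebra M" "closed M" and x: "x \<in> M" "x\<^sup>\<dagger> = x" "norm x < 1"
  obtains c where "c \<in> M" "c\<^sup>\<dagger> = c" "c o\<^sub>L c = id_blinfun - x"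
proof -
  \<comment> \<open>The smaller root of \<open>r^2 - 2 * r + norm x = 0\<close>: with it
    \<open>F\<close> maps the ball of radius \<open>r\<close> into itself, and \<open>r < 1\<close>
    is also its Lipschitz constant there.\<close>
  define r where "r = 1 - sqrt (1 - norm x)"
  have "sqrt (1 - norm x) \<le> 1" by simp
  then have r: "0 \<le> r" "r < 1" using x by (auto simp: r_def)
  have "(1 - r)\<^sup>2 = 1 - norm x" using x by (simp add: r_def)
  then have r2: "norm x + r * r = 2 * r" by (simp add: power2_eq_square algebra_simps)
  define F where "F y = (1/2) *\<^sub>R (x + (y o\<^sub>L y))" for y :: "'h \<Rightarrow>\<^sub>L 'h"
  define S where "S = {y \<in> M. y\<^sup>\<dagger> = y \<and> norm y \<le> r}"
  \<comment> \<open>Self-adjointness is rewritten as a family of closed conditions, so that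
    \<open>S\<close> is complete.\<close>
  have "S = M \<inter> {y :: 'h \<Rightarrow>\<^sub>L 'h. \<forall>u v. inner (y u) v = inner u (y v)} \<inter> {y. norm y \<le> r}"
    using star_subalgebra_cbounded[OF M(1)] selfadjoint_iff_inner by (auto simp: S_def)
  moreover have "closed {y :: 'h \<Rightarrow>\<^sub>L 'h. \<forall>u v. inner (y u) v = inner u (y v)}"
    by (intro closed_Collect_all closed_Collect_eq continuous_intros)
  moreover have "closed {y :: 'h \<Rightarrow>\<^sub>L 'h. norm y \<le> r}"
    by (intro closed_Collect_le continuous_intros)
  ultimately have "closed S" using M by auto
  then have cS: "complete S" by (simp add: complete_eq_closed)
  have "x - x \<in> M" using x by (intro star_subalgebra_closed[OF M(1)])
  then have "0 \<in> S" using r by (auto simp: S_def selfadjoint_iff_inner star_subalgebra_cbounded[OF M(1)])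
  then have S0: "S \<noteq> {}" by blast
  have xc: "x \<in> cbounded_ops" using x star_subalgebra_cbounded[OF M(1)] by blast
  have FS: "F ` S \<subseteq> S"
  proof
    fix z assume "z \<in> F ` S"
    then obtain y where y: "y \<in> S" "z = F y" by blast
    have yM: "y \<in> M" "y\<^sup>\<dagger> = y" "norm y \<le> r" using y by (auto simp: S_def)
    have yc: "y \<in> cbounded_ops" using yM star_subalgebra_cbounded[OF M(1)] by blast
    have zM: "F y \<in> M"
      using yM x unfolding F_def by (intro star_subalgebra_closed[OF M(1)])
    have "(F y)\<^sup>\<dagger> = F y"
    proof (subst selfadjoint_iff_inner)
      show "F y \<in> cbounded_ops" using zM star_subalgebra_cbounded[OF M(1)] by blast
      have "inner (x u) v = inner u (x v)" "inner (y u) v = inner u (y v)" for u v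
        using selfadjoint_iff_inner[OF xc] selfadjoint_iff_inner[OF yc] x yM by auto
      then show "\<forall>u v. inner (F y u) v = inner u (F y v)"
        by (simp add: F_def blinfun.scaleR_left blinfun.add_left inner_simps)
    qed
    moreover have "norm (F y) \<le> r"
    proof -
      have "norm (x + (y o\<^sub>L y)) \<le> norm x + r * r"
        using norm_triangle_ineq[of x "y o\<^sub>L y"] norm_blinfun_compose_le_mult[OF yM(3) yM(3)] by linarith
      then show ?thesis by (simp add: F_def r2)
    qed
    ultimately show "z \<in> S" using y zM by (auto simp: S_def)
  qed
  have lip: "dist (F y) (F z) \<le> r * dist y z" if "y \<in> S" "z \<in> S" for y z
  proof -
    have yz: "norm y \<le> r" "norm z \<le> r" using that by (auto simp: S_def)
    \<comment> \<open>This splitting of \<open>y^2 - z^2\<close> does not require \<open>y\<close>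
      and \<open>z\<close> to commute.\<close>
    have "F y - F z = (1/2) *\<^sub>R ((y o\<^sub>L (y - z)) + ((y - z) o\<^sub>L z))"
      by (rule blinfun_eqI) (simp add: F_def blinfun.bilinear_simps algebra_simps)
    then have "norm (F y - F z) = norm ((y o\<^sub>L (y - z)) + ((y - z) o\<^sub>L z)) / 2"
      by simp
    also have "\<dots> \<le> (r * norm (y - z) + norm (y - z) * r) / 2"
      by (intro divide_right_mono norm_triangle_le add_mono
          norm_blinfun_compose_le_mult[OF yz(1) order_refl]
          norm_blinfun_compose_le_mult[OF order_refl yz(2)]) simp
    finally show ?thesis by (simp add: dist_norm)
  qed
  obtain y where y: "y \<in> S" "F y = y"
    using Banach_fix[OF cS S0 r FS] lip by blast
  have yM: "y \<in> M" "y\<^sup>\<dagger> = y" using y by (auto simp: S_def)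
  have "x + (y o\<^sub>L y) = 2 *\<^sub>R y"
    using arg_cong[OF y(2), of "\<lambda>a. 2 *\<^sub>R a"] by (simp add: F_def)
  then have yy: "y o\<^sub>L y = 2 *\<^sub>R y - x" by (simp add: eq_diff_eq add.commute)
  have "y (y v) = 2 *\<^sub>R y v - x v" for v
    using arg_cong[OF yy, of "\<lambda>a. blinfun_apply a v"] by (simp add: blinfun.bilinear_simps)
  then have "(id_blinfun - y) o\<^sub>L (id_blinfun - y) = id_blinfun - x"
    by (intro blinfun_eqI) (simp add: blinfun.bilinear_simps scaleR_2)
  moreover have "id_blinfun - y \<in> M" using yM by (intro star_subalgebra_closed[OF M(1)] star_subalgebra_id[OF M(1)])
  moreover have "(id_blinfun - y)\<^sup>\<dagger> = id_blinfun - y"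
    using yM star_subalgebra_id[OF M(1)] by (simp add: cadjoint_diff cadjoint_id star_subalgebra_cbounded[OF M(1)])
  ultimately show thesis using that by blast
qed

section \<open>The operator order and positive functionals\<close>

lemma op_le_zero_iff: "op_le 0 p \<longleftrightarrow> (\<forall>x. cinner x (p x) \<in> \<real>\<^sub>\<ge>\<^sub>0)"
  by (simp add: op_le_def)

lemma op_le_trans: "op_le a b \<Longrightarrow> op_le b c \<Longrightarrow> op_le a c"
  unfolding op_le_def
proof
  fix x
  assume "\<forall>x. cinner x ((b - a) x) \<in> \<real>\<^sub>\<ge>\<^sub>0" "\<forall>x. cinner x ((c - b) x) \<in> \<real>\<^sub>\<ge>\<^sub>0"
  then have "cinner x ((b - a) x) + cinner x ((c - b) x) \<in> \<real>\<^sub>\<ge>\<^sub>0"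
    by (intro nonneg_Reals_add_I) auto
  then show "cinner x ((c - a) x) \<in> \<real>\<^sub>\<ge>\<^sub>0"
    by (simp add: blinfun.diff_left cinner.diff_right)
qed

lemma op_le_zero_diff: "op_le 0 (b - a) \<longleftrightarrow> op_le a b"
  by (simp add: op_le_def)

lemma op_le_inner: "op_le a b \<Longrightarrow> inner x (a x) \<le> inner x (b x)"
  unfolding op_le_def inner_eq_Re_cinner
  by (auto simp: blinfun.diff_left cinner.diff_right complex_nonneg_Reals_iff)

lemma positive_selfadjoint:
  assumes "p \<in> cbounded_ops" "op_le 0 p"
  shows "p\<^sup>\<dagger> = p"
  using assms by (intro selfadjoint_if_real_quadratic_form) (auto simp: op_le_zero_iff nonneg_Reals_subset_Reals[THEN subsetD])

text \<open>With \<open>K = norm p + e\<close> the operator \<open>(p + e) / K\<close> has the form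
  \<open>1 - x\<close> with \<open>norm x <= 1 - e / K < 1\<close>, so its square root exists inside
  \<open>M\<close>. The shift by \<open>e\<close> provides the strict inequality.\<close>

lemma positive_plus_eps_square:
  fixes p :: "'h::chilbert_space \<Rightarrow>\<^sub>L 'h"
  assumes M: "star_subalgebra M" "closed M" and p: "p \<in> M" "op_le 0 p" and e: "0 < e"
  obtains c K where "c \<in> M" "c\<^sup>\<dagger> = c" "0 < K" "p + e *\<^sub>R id_blinfun = K *\<^sub>R (c o\<^sub>L c)"
proof -
  define K where "K = norm p + e"
  have K: "K > 0" "e \<le> K" using e by (auto simp: K_def add_nonneg_pos)
  define x where "x = id_blinfun - (1 / K) *\<^sub>R (p + e *\<^sub>R id_blinfun)"
  have xM: "x \<in> M" unfolding x_def by (intro star_subalgebra_closed[OF M(1)] p star_subalgebra_id[OF M(1)])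
  note cb = star_subalgebra_cbounded[OF M(1)]
  have sp: "inner (p u) v = inner u (p v)" for u v
    using positive_selfadjoint[OF cb[OF p(1)] p(2)] selfadjoint_iff_inner[OF cb[OF p(1)]] by auto
  have sx: "inner (x u) v = inner u (x v)" for u v
    by (simp add: x_def blinfun.bilinear_simps inner_simps sp)
  have "norm x \<le> 1 - e / K"
  proof (rule norm_symmetric_le[OF sx])
    fix u
    have 1: "0 \<le> inner u (p u)" using op_le_inner[OF p(2), of u] by simp
    have "inner u (p u) \<le> norm u * (norm p * norm u)"
      by (meson mult_left_mono norm_blinfun norm_cauchy_schwarz norm_ge_zero order.trans)
    then have 2: "inner u (p u) \<le> norm p * inner u u"
      by (simp add: dot_square_norm power2_eq_square mult_ac)
    have 3: "K * inner u (x u) = (K - e) * inner u u - inner u (p u)"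
      using K by (simp add: x_def blinfun.bilinear_simps inner_simps field_simps)
    have "K * ((1 - e / K) * inner u u) = (K - e) * inner u u"
      using K by (simp add: field_simps)
    moreover have "K * \<bar>inner u (x u)\<bar> = \<bar>K * inner u (x u)\<bar>"
      using K by (simp add: abs_mult)
    moreover have "\<dots> \<le> (K - e) * inner u u"
      unfolding 3 using 1 2 by (auto simp: K_def abs_le_iff)
    ultimately have "K * \<bar>inner u (x u)\<bar> \<le> K * ((1 - e / K) * inner u u)" by linarith
    then show "\<bar>inner u (x u)\<bar> \<le> (1 - e / K) * inner u u" using K(1) by (simp only: mult_le_cancel_left_pos)
  qed (use K in simp)
  also have "\<dots> < 1" using K e by simp
  finally have nx: "norm x < 1" .
  have "x\<^sup>\<dagger> = x" using selfadjoint_iff_inner[OF cb[OF xM]] sx by blast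
  from square_root_id_minus[OF M xM this nx] obtain c
    where c: "c \<in> M" "c\<^sup>\<dagger> = c" "c o\<^sub>L c = id_blinfun - x" by blast
  have "p + e *\<^sub>R id_blinfun = K *\<^sub>R (c o\<^sub>L c)" using K(1) by (simp add: c(3) x_def)
  with c K(1) show thesis using that by blast
qed

lemma id_compose_id: "id_blinfun o\<^sub>L id_blinfun = id_blinfun"
  by (rule blinfun_eqI) simp

text \<open>The perturbation \<open>p + e\<close> is a positive multiple of a square in
  \<open>M\<close>, on which \<open>F\<close> is nonnegative; then \<open>e\<close> tends to zero.
  This is how positivity on squares reaches all positive elements.\<close>

lemma positive_functional_nonneg:
  fixes F :: "('h::chilbert_space \<Rightarrow>\<^sub>L 'h) \<Rightarrow> complex"
  assumes M: "star_subalgebra M" "closed M" and F: "clinear_on M F"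
    and pos: "\<And>c. c \<in> M \<Longrightarrow> F (c\<^sup>\<dagger> o\<^sub>L c) \<in> \<real>\<^sub>\<ge>\<^sub>0"
    and p: "p \<in> M" "op_le 0 p"
  shows "F p \<in> \<real>\<^sub>\<ge>\<^sub>0"
proof -
  have idM: "id_blinfun \<in> M" using star_subalgebra_id[OF M(1)] .
  have F1: "F id_blinfun \<in> \<real>\<^sub>\<ge>\<^sub>0" using pos[OF idM] by (simp add: cadjoint_id id_compose_id)
  have e: "F p + complex_of_real e * F id_blinfun \<in> \<real>\<^sub>\<ge>\<^sub>0" if "e > 0" for e
  proof -
    from positive_plus_eps_square[OF M p that] obtain c K
      where c: "c \<in> M" "c\<^sup>\<dagger> = c" "0 < K" "p + e *\<^sub>R id_blinfun = K *\<^sub>R (c o\<^sub>L c)" by blast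
    have "F p + complex_of_real e * F id_blinfun = F (p + e *\<^sub>R id_blinfun)"
      by (simp add: clinear_onD[OF F] p idM star_subalgebra_closed[OF M(1)] scaleR_conv_of_real)
    also have "\<dots> = complex_of_real K * F (c o\<^sub>L c)"
      by (simp add: c clinear_onD[OF F] star_subalgebra_closed[OF M(1)] scaleR_conv_of_real)
    finally show ?thesis using pos[OF c(1)] c by (simp add: nonneg_Reals_mult_I)
  qed
  have im: "Im (F p) = 0" using e[of 1] F1 by (simp add: complex_nonneg_Reals_iff)
  have "0 \<le> Re (F p)"
  proof (rule field_le_epsilon)
    fix d :: real assume d: "d > 0"
    have b: "Re (F id_blinfun) \<ge> 0" "Im (F id_blinfun) = 0" using F1 by (simp_all add: complex_nonneg_Reals_iff)
    \<comment> \<open>The summand 1 keeps the denominator positive even if \<open>F\<close> vanishes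
      at the identity.\<close>
    define e' where "e' = d / (Re (F id_blinfun) + 1)"
    have e': "e' > 0" using d b by (simp add: e'_def)
    have "0 \<le> Re (F p) + e' * Re (F id_blinfun)"
      using e[OF e'] by (simp add: complex_nonneg_Reals_iff)
    also have "e' * Re (F id_blinfun) \<le> d"
      using b d by (simp add: e'_def field_simps)
    finally show "0 \<le> Re (F p) + d" by simp
  qed
  then show ?thesis using im by (simp add: complex_nonneg_Reals_iff)
qed

section \<open>Consequences of the Schwartz inequality\<close>

lemma unital_schwartz_mapD:
  assumes "unital_schwartz_map M \<Psi>"
  shows "a \<in> M \<Longrightarrow> \<Psi> a \<in> M" "clinear_on M \<Psi>" "\<Psi> id_blinfun = id_blinfun"
    "a \<in> M \<Longrightarrow> op_le 0 (\<Psi> (a\<^sup>\<dagger>) o\<^sub>L \<Psi> a)"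
    "a \<in> M \<Longrightarrow> op_le (\<Psi> (a\<^sup>\<dagger>) o\<^sub>L \<Psi> a) (\<Psi> (a\<^sup>\<dagger> o\<^sub>L a))"
  using assms by (auto simp: unital_schwartz_map_def)

text \<open>For fixed \<open>x\<close> the functional sending \<open>a\<close> to
  \<open>cinner x (\<Psi> a x)\<close> is nonnegative on squares by the two halves of the Schwartz
  condition, hence on all positive elements.\<close>

lemma schwartz_map_positive:
  assumes M: "star_subalgebra M" "closed M" and S: "unital_schwartz_map M \<Psi>"
    and p: "p \<in> M" "op_le 0 p"
  shows "op_le 0 (\<Psi> p)"
  unfolding op_le_zero_iff
proof
  fix x
  note lin = clinear_onD[OF unital_schwartz_mapD(2)[OF S]]
  show "cinner x (\<Psi> p x) \<in> \<real>\<^sub>\<ge>\<^sub>0"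
  proof (rule positive_functional_nonneg[OF M _ _ p])
    show "clinear_on M (\<lambda>a. cinner x (\<Psi> a x))"
      using lin by (auto simp: clinear_on_def blinfun.add_left cinner_add_right
          blinfun_apply_scaleC cinner_scaleC_right scaleC_complex_def)
    show "cinner x (\<Psi> (c\<^sup>\<dagger> o\<^sub>L c) x) \<in> \<real>\<^sub>\<ge>\<^sub>0" if "c \<in> M" for c
      using op_le_trans[OF unital_schwartz_mapD(4,5)[OF S that]] by (simp add: op_le_zero_iff)
  qed
qed

lemma cadjoint_square_positive:
  assumes "a \<in> cbounded_ops"
  shows "op_le 0 (a\<^sup>\<dagger> o\<^sub>L a)"
  using assms by (simp add: op_le_zero_iff cinner_cadjoint_right cinner_self complex_nonneg_Reals_iff del: of_real_power)

text \<open>The identity \<open>4 h = (1 + h)^2 - (1 - h)^2\<close> writes \<open>h\<close> through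
  squares of self-adjoint elements, whose images are positive and so have real quadratic
  forms.\<close>

lemma schwartz_map_selfadjoint:
  assumes M: "star_subalgebra M" "closed M" and S: "unital_schwartz_map M \<Psi>"
    and h: "h \<in> M" "h\<^sup>\<dagger> = h"
  shows "(\<Psi> h)\<^sup>\<dagger> = \<Psi> h"
proof (rule selfadjoint_if_real_quadratic_form)
  note al = star_subalgebra_closed[OF M(1)] and cb = star_subalgebra_cbounded[OF M(1)]
  note lin = clinear_onD[OF unital_schwartz_mapD(2)[OF S]]
  have idM: "id_blinfun \<in> M" by (rule star_subalgebra_id[OF M(1)])
  define u v where "u = id_blinfun + h" and "v = id_blinfun - h"
  have uv: "u \<in> M" "v \<in> M" using h idM by (auto simp: u_def v_def intro: al)
  have uv_sa: "u\<^sup>\<dagger> = u" "v\<^sup>\<dagger> = v"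
    using h idM cb by (simp_all add: u_def v_def cadjoint_add cadjoint_diff cadjoint_id)
  have pos: "op_le 0 (\<Psi> (w o\<^sub>L w))" if "w \<in> M" "w\<^sup>\<dagger> = w" for w
    using cadjoint_square_positive[OF cb[OF that(1)]] that
    by (intro schwartz_map_positive[OF M S] al) auto
  have "4 *\<^sub>R h = (u o\<^sub>L u) - (v o\<^sub>L v)"
    by (rule blinfun_eqI) (simp add: u_def v_def blinfun.bilinear_simps scaleR_add_left[of 2 2, simplified] scaleR_2)
  then have "4 *\<^sub>R \<Psi> h = \<Psi> (u o\<^sub>L u) - \<Psi> (v o\<^sub>L v)"
    using lin(3)[OF h(1), of 4] lin(4)[of "u o\<^sub>L u" "v o\<^sub>L v"] by (simp add: al uv)
  then have eq: "4 *\<^sub>R cinner x (\<Psi> h x) = cinner x (\<Psi> (u o\<^sub>L u) x) - cinner x (\<Psi> (v o\<^sub>L v) x)" for x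
    by (metis blinfun.diff_left blinfun.scaleR_left cinner.diff_right cinner.scaleR_right)
  show "cinner x (\<Psi> h x) \<in> \<real>" for x
  proof -
    have "Im (4 *\<^sub>R cinner x (\<Psi> h x)) = 0"
      unfolding eq using pos[OF uv(1) uv_sa(1)] pos[OF uv(2) uv_sa(2)]
      by (simp add: op_le_zero_iff complex_nonneg_Reals_iff)
    then show ?thesis by (simp add: complex_is_Real_iff)
  qed
  show "\<Psi> h \<in> cbounded_ops" by (rule cb[OF unital_schwartz_mapD(1)[OF S h(1)]])
qed

text \<open>The self-adjoint elements \<open>h\<close> and \<open>k\<close>, twice the real part of
  \<open>a\<close> and minus twice its imaginary part, have self-adjoint images. This determines the
  sum and the difference of the adjoints of \<open>A\<close> and \<open>B\<close>, and adding the
  two yields the claim.\<close>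

lemma schwartz_map_cadjoint:
  assumes M: "star_subalgebra M" "closed M" and S: "unital_schwartz_map M \<Psi>" and a: "a \<in> M"
  shows "\<Psi> (a\<^sup>\<dagger>) = (\<Psi> a)\<^sup>\<dagger>"
proof -
  note al = star_subalgebra_closed[OF M(1)] and cb = star_subalgebra_cbounded[OF M(1)]
  note lin = clinear_onD[OF unital_schwartz_mapD(2)[OF S]]
  define h k where "h = a + a\<^sup>\<dagger>" and "k = \<i> *\<^sub>C (a - a\<^sup>\<dagger>)"
  have aM: "a\<^sup>\<dagger> \<in> M" by (intro al a)
  have hk: "h \<in> M" "k \<in> M" using a aM by (auto simp: h_def k_def intro: al)
  have hs: "h\<^sup>\<dagger> = h"
    using cb[OF a] cb[OF aM] by (simp add: h_def cadjoint_add cadjoint_cadjoint add.commute)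
  have ks: "k\<^sup>\<dagger> = k"
  proof -
    have "k\<^sup>\<dagger> = (- \<i>) *\<^sub>C (a\<^sup>\<dagger> - a)"
      using cb[OF a] cb[OF aM] cb[OF al(6)[OF a aM]]
      by (simp add: k_def cadjoint_scaleC cadjoint_diff cadjoint_cadjoint)
    also have "\<dots> = k"
      using scaleC_minus_right[of \<i> "a\<^sup>\<dagger> - a"] unfolding k_def minus_diff_eq by (rule sym)
    finally show ?thesis .
  qed
  define A B where "A = \<Psi> a" and "B = \<Psi> (a\<^sup>\<dagger>)"
  have AB: "A \<in> cbounded_ops" "B \<in> cbounded_ops"
    using unital_schwartz_mapD(1)[OF S a] unital_schwartz_mapD(1)[OF S aM] cb by (auto simp: A_def B_def)
  have "\<Psi> h = A + B" using lin(1)[OF a aM] by (simp add: h_def A_def B_def)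
  with schwartz_map_selfadjoint[OF M S hk(1) hs] have 1: "A\<^sup>\<dagger> + B\<^sup>\<dagger> = A + B"
    using AB by (simp add: cadjoint_add)
  have "\<Psi> k = \<i> *\<^sub>C (A - B)"
    using lin(2)[of "a - a\<^sup>\<dagger>" \<i>] lin(4)[OF a aM] a aM by (simp add: k_def A_def B_def al)
  moreover have "A - B \<in> cbounded_ops"
    using AB by (intro cbounded_opsI) (simp add: cbounded_opsD blinfun.diff_left linear_diff[OF bounded_linear.linear[OF bounded_linear_scaleC]])
  ultimately have "(- \<i>) *\<^sub>C (A\<^sup>\<dagger> - B\<^sup>\<dagger>) = \<i> *\<^sub>C (A - B)"
    using schwartz_map_selfadjoint[OF M S hk(2) ks] AB
    by (simp add: cadjoint_scaleC cadjoint_diff)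
  then have "\<i> *\<^sub>C (- \<i>) *\<^sub>C (A\<^sup>\<dagger> - B\<^sup>\<dagger>) = \<i> *\<^sub>C \<i> *\<^sub>C (A - B)" by simp
  then have 2: "A\<^sup>\<dagger> - B\<^sup>\<dagger> = - (A - B)"
    using scaleC_of_real[of 1 "A\<^sup>\<dagger> - B\<^sup>\<dagger>"] by (simp add: scaleC_scaleC scaleC_minus_one)
  have "2 *\<^sub>R (A\<^sup>\<dagger>) = (A\<^sup>\<dagger> + B\<^sup>\<dagger>) + (A\<^sup>\<dagger> - B\<^sup>\<dagger>)" by (simp add: scaleR_2)
  also have "\<dots> = 2 *\<^sub>R B" unfolding 1 2 by (simp add: scaleR_2)
  finally show ?thesis by (simp add: A_def B_def)
qed

text \<open>For \<open>s\<close> strictly above the squared norm of \<open>a\<close>, the element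
  \<open>1 - x\<close> with \<open>x = a\<^sup>\<dagger> a / s\<close> is a square in
  \<open>M\<close>. Positivity then bounds the image of \<open>a\<^sup>\<dagger> a\<close> by
  \<open>s\<close>, the Schwartz inequality bounds \<open>\<Psi> a\<close>, and \<open>s\<close>
  decreases to its limit. The bound keeps orbits inside weakly compact balls.\<close>

lemma schwartz_map_norm_le:
  assumes M: "star_subalgebra M" "closed M" and S: "unital_schwartz_map M \<Psi>" and a: "a \<in> M"
  shows "norm (\<Psi> a) \<le> norm a"
proof (rule norm_blinfun_bound)
  fix y
  note al = star_subalgebra_closed[OF M(1)] and cb = star_subalgebra_cbounded[OF M(1)]
  note lin = clinear_onD[OF unital_schwartz_mapD(2)[OF S]]
  have aaM: "a\<^sup>\<dagger> o\<^sub>L a \<in> M" by (intro al a)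
  have idM: "id_blinfun \<in> M" by (rule star_subalgebra_id[OF M(1)])
  have *: "(norm (\<Psi> a y))\<^sup>2 \<le> s * (norm y)\<^sup>2" if s: "s > (norm a)\<^sup>2" for s
  proof -
    have s0: "s > 0" using s zero_le_power2[of "norm a"] by linarith
    define x where "x = (1 / s) *\<^sub>R (a\<^sup>\<dagger> o\<^sub>L a)"
    have "norm (a\<^sup>\<dagger> o\<^sub>L a) \<le> norm a * norm a"
      by (rule norm_blinfun_compose_le_mult[OF norm_cadjoint_le[OF cb[OF a]] order_refl])
    also have "\<dots> < s" using s by (simp add: power2_eq_square)
    finally have nx: "norm x < 1" using s0 by (simp add: x_def)
    have xM: "x \<in> M" unfolding x_def by (intro al aaM)
    have "inner (x u) v = inner u (x v)" for u v
      using cb[OF a] by (simp add: x_def blinfun.scaleR_left inner_eq_Re_cinner cinner_cadjoint_left cinner_cadjoint_right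
         scaleR_conv_of_real cinner.scaleR_left cinner.scaleR_right)
    then have "x\<^sup>\<dagger> = x" using selfadjoint_iff_inner[OF cb[OF xM]] by blast
    from square_root_id_minus[OF M xM this nx] obtain c
      where c: "c \<in> M" "c\<^sup>\<dagger> = c" "c o\<^sub>L c = id_blinfun - x" by blast
    have "op_le 0 (c o\<^sub>L c)" using cadjoint_square_positive[OF cb[OF c(1)]] c by simp
    then have "op_le 0 (\<Psi> (id_blinfun - x))"
      using schwartz_map_positive[OF M S al(5)[OF c(1) c(1)]] c(3) by simp
    also have "\<Psi> (id_blinfun - x) = id_blinfun - (1 / s) *\<^sub>R \<Psi> (a\<^sup>\<dagger> o\<^sub>L a)"
      using lin(4)[OF idM xM al(2)[OF xM]] lin(3)[OF aaM] unital_schwartz_mapD(3)[OF S] by (simp add: x_def)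
    finally have "inner y (((1 / s) *\<^sub>R \<Psi> (a\<^sup>\<dagger> o\<^sub>L a)) y) \<le> inner y y"
      using op_le_inner[of _ id_blinfun y] by (fastforce simp: op_le_zero_diff)
    then have 1: "inner y (\<Psi> (a\<^sup>\<dagger> o\<^sub>L a) y) \<le> s * (norm y)\<^sup>2"
      using s0 by (simp add: blinfun.scaleR_left field_simps dot_square_norm)
    have "\<Psi> a \<in> cbounded_ops" by (rule cb[OF unital_schwartz_mapD(1)[OF S a]])
    then have "(norm (\<Psi> a y))\<^sup>2 = inner y ((\<Psi> (a\<^sup>\<dagger>) o\<^sub>L \<Psi> a) y)"
      by (simp add: schwartz_map_cadjoint[OF M S a] inner_eq_Re_cinner cinner_cadjoint_right cinner_self del: of_real_power)
    also have "\<dots> \<le> inner y (\<Psi> (a\<^sup>\<dagger> o\<^sub>L a) y)"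
      by (rule op_le_inner[OF unital_schwartz_mapD(5)[OF S a]])
    finally show ?thesis using 1 by simp
  qed
  have "(norm (\<Psi> a y))\<^sup>2 \<le> (norm a)\<^sup>2 * (norm y)\<^sup>2"
  proof (cases "y = 0")
    case False
    then have "(norm (\<Psi> a y))\<^sup>2 / (norm y)\<^sup>2 \<le> s" if "s > (norm a)\<^sup>2" for s
      using *[OF that] by (simp add: field_simps)
    then have "(norm (\<Psi> a y))\<^sup>2 / (norm y)\<^sup>2 \<le> (norm a)\<^sup>2" by (rule dense_ge)
    then show ?thesis using False by (simp add: field_simps)
  qed simp
  then show "norm (\<Psi> a y) \<le> norm a * norm y"
    by (simp add: power_mult_distrib[symmetric])
qed simp

section \<open>Operator topologies\<close>

text \<open>The topology is a pullback of the product topology on functions, where convergence is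
  coordinatewise.\<close>

lemma limitin_strong_operator_topology_iff:
  "limitin strong_operator_topology A V F \<longleftrightarrow> (\<forall>x. ((\<lambda>n. blinfun_apply (A n) x) \<longlongrightarrow> blinfun_apply V x) F)"
proof
  assume L: "limitin strong_operator_topology A V F"
  show "\<forall>x. ((\<lambda>n. A n x) \<longlongrightarrow> V x) F"
    using continuous_map_limit[OF strong_operator_topology_continuous_evaluation L] by (simp add: o_def)
next
  assume "\<forall>x. ((\<lambda>n. A n x) \<longlongrightarrow> V x) F"
  then have "limitin (product_topology (\<lambda>i. euclidean) UNIV) (\<lambda>n. blinfun_apply (A n)) (blinfun_apply V) F"
    by (simp add: limitin_componentwise)
  then have *: "((\<lambda>n. blinfun_apply (A n)) \<longlongrightarrow> blinfun_apply V) F"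
    by (simp add: euclidean_product_topology)
  show "limitin strong_operator_topology A V F"
    unfolding limitin_def
  proof (intro conjI allI impI)
    show "V \<in> topspace strong_operator_topology" by (simp add: strong_operator_topology_topspace)
    fix U assume U: "openin strong_operator_topology U \<and> V \<in> U"
    then obtain S where S: "open S" "U = blinfun_apply -` S"
      unfolding strong_operator_topology_def by (subst (asm) openin_pullback_topology) auto
    then show "\<forall>\<^sub>F n in F. A n \<in> U"
      using topological_tendstoD[OF * S(1)] U by auto
  qed
qed

lemma sot_lim_eqI:
  assumes "\<And>x. (\<lambda>n. blinfun_apply (A n) x) \<longlonglongrightarrow> blinfun_apply V x"
  shows "sot_lim A = V"
  unfolding sot_lim_def limitin_strong_operator_topology_iff
proof (rule the_equality)
  show "W = V" if "\<forall>x. (\<lambda>n. A n x) \<longlonglongrightarrow> blinfun_apply W x" for W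
    using that assms by (intro blinfun_eqI) (blast intro: LIMSEQ_unique)
qed (use assms in blast)

lemma strong_limit_exists:
  fixes A :: "nat \<Rightarrow> 'a::real_normed_vector \<Rightarrow>\<^sub>L 'b::real_normed_vector"
  assumes A: "\<And>n. norm (A n) \<le> K" and conv: "\<And>x. convergent (\<lambda>n. A n x)"
  obtains V where "norm V \<le> K" "\<And>x. (\<lambda>n. A n x) \<longlonglongrightarrow> blinfun_apply V x"
proof -
  define f where "f x = lim (\<lambda>n. A n x)" for x
  have f: "(\<lambda>n. A n x) \<longlonglongrightarrow> f x" for x
    using conv by (simp add: f_def convergent_LIMSEQ_iff)
  have K: "0 \<le> K" using A[of 0] norm_ge_zero order.trans by blast
  have bound: "norm (A n x) \<le> K * norm x" for n x
    by (meson A mult_right_mono norm_blinfun norm_ge_zero order.trans)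
  have "bounded_linear f"
  proof (rule bounded_linear_intro)
    show "f (x + y) = f x + f y" for x y
      using tendsto_add[OF f f] by (intro LIMSEQ_unique[OF f]) (simp add: blinfun.add_right)
    show "f (r *\<^sub>R x) = r *\<^sub>R f x" for x r
      using tendsto_scaleR[OF tendsto_const f] by (intro LIMSEQ_unique[OF f]) (simp add: blinfun.scaleR_right)
    show "norm (f x) \<le> norm x * K" for x
      using bound by (intro LIMSEQ_le_const2[OF tendsto_norm[OF f]]) (auto simp: mult.commute)
  qed
  then have V: "blinfun_apply (Blinfun f) x = f x" for x
    by (simp add: bounded_linear_Blinfun_apply)
  have "norm (Blinfun f) \<le> K"
    by (rule norm_blinfun_bound[OF K], unfold V, rule LIMSEQ_le_const2[OF tendsto_norm[OF f]]) (use bound in auto)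
  then show thesis using that V f by metis
qed

section \<open>Convergence in topologies generated by seminorms\<close>

lemma limitin_seminorm_topologyD:
  assumes L: "limitin (seminorm_topology P) f l F" and p: "p \<in> P" "p 0 = 0" and e: "0 < e"
  shows "\<forall>\<^sub>F n in F. p (f n - l) < e"
proof -
  have "openin (seminorm_topology P) {b. p (b - l) < e}"
    unfolding seminorm_topology_def by (rule topology_generated_by_Basis) (use p e in blast)
  from limitinD[OF L this] show ?thesis using p e by simp
qed

lemma limitin_seminorm_topologyI:
  assumes P: "P \<noteq> {}" "\<And>p. p \<in> P \<Longrightarrow> p 0 = 0" "\<And>p x y. p \<in> P \<Longrightarrow> p (x + y) \<le> p x + p y"
    and lim: "\<And>p. p \<in> P \<Longrightarrow> ((\<lambda>n. p (f n - l)) \<longlongrightarrow> 0) F"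
  shows "limitin (seminorm_topology P) f l F"
proof -
  let ?S = "{{b. p (b - a) < e} | p a e. p \<in> P \<and> 0 < e}"
  \<comment> \<open>A generated topology has the union of its generators as \<open>topspace\<close>;
    some seminorm must exist for \<open>l\<close> to lie in it.\<close>
  obtain p where p: "p \<in> P" using P(1) by blast
  have "{b. p (b - l) < 1} \<in> ?S" using p zero_less_one by blast
  moreover have "l \<in> {b. p (b - l) < 1}" using P(2)[OF p] by simp
  ultimately have top: "l \<in> topspace (seminorm_topology P)"
    unfolding seminorm_topology_def topology_generated_by_topspace by blast
  have "\<forall>\<^sub>F n in F. f n \<in> U" if "generate_topology_on ?S U" "l \<in> U" for U
    using that
  proof (induction rule: generate_topology_on.induct)
    case (Int a b)
    then show ?case by (auto intro: eventually_conj)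
  next
    case (UN K)
    then obtain k where k: "k \<in> K" "l \<in> k" by blast
    from UN.IH[OF this] show ?case by (rule eventually_mono) (use k in blast)
  next
    case (Basis s)
    then obtain p a e where s: "s = {b. p (b - a) < e}" "p \<in> P" by blast
    \<comment> \<open>A generating ball may be centred anywhere; around \<open>l\<close> it contains
      the ball of radius \<open>e - p (l - a)\<close>.\<close>
    have "p (l - a) < e" using Basis s by simp
    then have "\<forall>\<^sub>F n in F. p (f n - l) < e - p (l - a)"
      by (intro order_tendstoD(2)[OF lim[OF s(2)]]) simp
    then show ?case
    proof (rule eventually_mono)
      fix n assume "p (f n - l) < e - p (l - a)"
      moreover have "p (f n - a) \<le> p (f n - l) + p (l - a)"
        using P(3)[OF s(2), of "f n - l" "l - a"] by simp
      ultimately show "f n \<in> s" by (simp add: s)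
    qed
  qed simp
  then show ?thesis
    using top unfolding limitin_def seminorm_topology_def openin_topology_generated_by_iff by blast
qed

lemma summable_bounded_pairing:
  fixes x y :: "nat \<Rightarrow> 'h::real_normed_vector"
  assumes "summable (\<lambda>n. (norm (x n))\<^sup>2)" "summable (\<lambda>n. (norm (y n))\<^sup>2)"
  shows "summable (\<lambda>n. norm (x n) * norm (y n))"
proof (rule summable_comparison_test')
  show "summable (\<lambda>n. (norm (x n))\<^sup>2 + (norm (y n))\<^sup>2)" using assms by (rule summable_add)
  show "norm (norm (x n) * norm (y n)) \<le> (norm (x n))\<^sup>2 + (norm (y n))\<^sup>2" for n
  proof -
    have "norm (norm (x n) * norm (y n)) = norm (x n) * norm (y n)" "0 \<le> norm (x n) * norm (y n)"
      by simp_all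
    then show ?thesis using sum_squares_bound[of "norm (x n)" "norm (y n)"] by linarith
  qed
qed

lemma norm_cinner_apply_le:
  "cmod (cinner x (blinfun_apply a y)) \<le> norm a * (norm x * norm y)"
proof -
  have "cmod (cinner x (a y)) \<le> norm x * (norm a * norm y)"
    by (meson mult_left_mono norm_blinfun norm_cinner_le norm_ge_zero order.trans)
  then show ?thesis by (simp add: mult_ac)
qed

lemma summable_cinner_apply:
  fixes x y :: "nat \<Rightarrow> 'h::chilbert_space"
  assumes "summable (\<lambda>n. (norm (x n))\<^sup>2)" "summable (\<lambda>n. (norm (y n))\<^sup>2)"
  shows "summable (\<lambda>n. cinner (x n) (blinfun_apply a (y n)))"
  by (rule summable_comparison_test'[OF summable_mult[OF summable_bounded_pairing[OF assms], of "norm a"]])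
    (rule norm_cinner_apply_le)

lemma limitin_ultraweakI:
  fixes f :: "'i \<Rightarrow> 'h::chilbert_space \<Rightarrow>\<^sub>L 'h"
  assumes "\<And>x y :: nat \<Rightarrow> 'h. summable (\<lambda>n. (norm (x n))\<^sup>2) \<Longrightarrow> summable (\<lambda>n. (norm (y n))\<^sup>2) \<Longrightarrow>
    ((\<lambda>i. \<Sum>n. cinner (x n) ((f i - l) (y n))) \<longlongrightarrow> 0) F"
  shows "limitin ultraweak_topology f l F"
  unfolding ultraweak_topology_def
proof (rule limitin_seminorm_topologyI)
  let ?P = "{\<lambda>a :: 'h \<Rightarrow>\<^sub>L 'h. cmod (\<Sum>n. cinner (x n) (a (y n))) | (x :: nat \<Rightarrow> 'h) (y :: nat \<Rightarrow> 'h).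
      summable (\<lambda>n. (norm (x n))\<^sup>2) \<and> summable (\<lambda>n. (norm (y n))\<^sup>2)}"
  have "(\<lambda>a :: 'h \<Rightarrow>\<^sub>L 'h. cmod (\<Sum>n. cinner ((\<lambda>_. 0) n) (a ((\<lambda>_. 0) n)))) \<in> ?P"
    by (rule CollectI, rule exI[of _ "\<lambda>_. 0"], rule exI[of _ "\<lambda>_. 0"]) simp
  then show "?P \<noteq> {}" by blast
  show "p 0 = 0" if "p \<in> ?P" for p using that by (auto simp: cinner.zero_right)
  show "p (a + b) \<le> p a + p b" if pP: "p \<in> ?P" for p a b
  proof -
    obtain x y :: "nat \<Rightarrow> 'h" where p: "p = (\<lambda>a. cmod (\<Sum>n. cinner (x n) (a (y n))))"
      and s: "summable (\<lambda>n. (norm (x n))\<^sup>2)" "summable (\<lambda>n. (norm (y n))\<^sup>2)" using pP by blast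
    have "(\<Sum>n. cinner (x n) ((a + b) (y n))) = (\<Sum>n. cinner (x n) (a (y n))) + (\<Sum>n. cinner (x n) (b (y n)))"
      using suminf_add[OF summable_cinner_apply[OF s] summable_cinner_apply[OF s]]
      by (simp add: blinfun.add_left cinner_add_right)
    then show ?thesis by (simp add: p norm_triangle_ineq)
  qed
  show "((\<lambda>i. p (f i - l)) \<longlongrightarrow> 0) F" if "p \<in> ?P" for p
    using that assms by (auto intro: tendsto_norm_zero)
qed

text \<open>A uniform norm bound dominates the series defining the ultraweak seminorms, so termwise
  convergence passes to the sums by dominated convergence (Tannery).\<close>

lemma limitin_ultraweak_if_bounded:
  fixes a :: "'i \<Rightarrow> 'h::chilbert_space \<Rightarrow>\<^sub>L 'h"
  assumes F: "F \<noteq> bot" and bd: "\<And>i. norm (a i) \<le> C"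
    and lim: "\<And>x y. ((\<lambda>i. cinner x (a i y)) \<longlongrightarrow> cinner x (blinfun_apply b y)) F"
  shows "limitin ultraweak_topology a b F"
proof (rule limitin_ultraweakI)
  fix x y :: "nat \<Rightarrow> 'h"
  assume s: "summable (\<lambda>n. (norm (x n))\<^sup>2)" "summable (\<lambda>n. (norm (y n))\<^sup>2)"
  have "norm (a i - b) \<le> C + norm b" for i
    using norm_triangle_ineq4[of "a i" b] bd[of i] by linarith
  then have bound: "cmod (cinner (x k) ((a i - b) (y k))) \<le> (C + norm b) * (norm (x k) * norm (y k))" for k i
    by (meson mult_nonneg_nonneg mult_right_mono norm_cinner_apply_le norm_ge_zero order.trans)
  have "((\<lambda>i. \<Sum>k. cinner (x k) ((a i - b) (y k))) \<longlongrightarrow> (\<Sum>k. 0)) F"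
  proof (rule tannerys_theorem[THEN conjunct2, THEN conjunct2])
    show "((\<lambda>i. cinner (x k) ((a i - b) (y k))) \<longlongrightarrow> 0) F" for k
      using tendsto_diff[OF lim[of "x k" "y k"] tendsto_const[of "cinner (x k) (b (y k))"]]
      by (simp add: blinfun.diff_left cinner.diff_right)
    show "summable (\<lambda>k. (C + norm b) * (norm (x k) * norm (y k)))"
      by (rule summable_mult[OF summable_bounded_pairing[OF s]])
    show "\<forall>\<^sub>F (k, i) in at_top \<times>\<^sub>F F. cmod (cinner (x k) ((a i - b) (y k))) \<le> (C + norm b) * (norm (x k) * norm (y k))"
      using bound by (intro always_eventually) auto
  qed (rule F)
  then show "((\<lambda>i. \<Sum>k. cinner (x k) ((a i - b) (y k))) \<longlongrightarrow> 0) F" by simp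
qed

text \<open>Moving the adjoint across gives terms \<open>cinner (a x) (a y)\<close>, which the
  arithmetic-geometric mean inequality bounds by the two ultrastrong seminorms of \<open>x\<close>
  and \<open>y\<close>. This makes ultrastrong decay visible to a normal state.\<close>

lemma limitin_ultraweak_cadjoint_square:
  fixes a :: "'i \<Rightarrow> 'h::chilbert_space \<Rightarrow>\<^sub>L 'h"
  assumes L: "limitin ultrastrong_topology a 0 F" and a: "\<And>i. a i \<in> cbounded_ops"
  shows "limitin ultraweak_topology (\<lambda>i. (a i)\<^sup>\<dagger> o\<^sub>L a i) 0 F"
proof (rule limitin_ultraweakI)
  fix x y :: "nat \<Rightarrow> 'h"
  assume s: "summable (\<lambda>n. (norm (x n))\<^sup>2)" "summable (\<lambda>n. (norm (y n))\<^sup>2)"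
  have sa: "summable (\<lambda>n. (norm (a i (z n)))\<^sup>2)" if "summable (\<lambda>n. (norm (z n))\<^sup>2)" for i and z :: "nat \<Rightarrow> 'h"
  proof (rule summable_comparison_test'[OF summable_mult[OF that]])
    show "norm ((norm (a i (z n)))\<^sup>2) \<le> (norm (a i))\<^sup>2 * (norm (z n))\<^sup>2" for n
      using power_mono[OF norm_blinfun[of "a i" "z n"], of 2] by (simp add: power_mult_distrib)
  qed
  have small: "\<forall>\<^sub>F i in F. (\<Sum>n. (norm (a i (z n)))\<^sup>2) < e" if z: "summable (\<lambda>n. (norm (z n))\<^sup>2)" and e: "0 < e"
    for z :: "nat \<Rightarrow> 'h" and e
  proof -
    have "\<forall>\<^sub>F i in F. sqrt (\<Sum>n. (norm ((a i - 0) (z n)))\<^sup>2) < sqrt e"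
      by (rule limitin_seminorm_topologyD[OF L[unfolded ultrastrong_topology_def]])
        (use z e in auto)
    then show ?thesis by simp
  qed
  show "((\<lambda>i. \<Sum>n. cinner (x n) ((((a i)\<^sup>\<dagger> o\<^sub>L a i) - 0) (y n))) \<longlongrightarrow> 0) F"
  proof (rule tendstoI)
    fix e :: real assume e: "e > 0"
    have "\<forall>\<^sub>F i in F. (\<Sum>n. (norm (a i (x n)))\<^sup>2) < e \<and> (\<Sum>n. (norm (a i (y n)))\<^sup>2) < e"
      using small[OF s(1) e] small[OF s(2) e] by (rule eventually_conj)
    then show "\<forall>\<^sub>F i in F. dist (\<Sum>n. cinner (x n) ((((a i)\<^sup>\<dagger> o\<^sub>L a i) - 0) (y n))) 0 < e"
    proof (rule eventually_mono)
      fix i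
      assume i: "(\<Sum>n. (norm (a i (x n)))\<^sup>2) < e \<and> (\<Sum>n. (norm (a i (y n)))\<^sup>2) < e"
      define u v where "u n = (norm (a i (x n)))\<^sup>2" and "v n = (norm (a i (y n)))\<^sup>2" for n
      have uv: "summable u" "summable v" unfolding u_def v_def using sa s by auto
      have "cmod (\<Sum>n. cinner (x n) ((((a i)\<^sup>\<dagger> o\<^sub>L a i) - 0) (y n))) \<le> (\<Sum>n. (u n + v n) / 2)"
      proof (rule norm_suminf_le)
        show "summable (\<lambda>n. (u n + v n) / 2)" by (intro summable_divide summable_add uv)
        fix n
        have "cinner (x n) ((((a i)\<^sup>\<dagger> o\<^sub>L a i) - 0) (y n)) = cinner (a i (x n)) (a i (y n))"
          by (simp add: cinner_cadjoint_right[OF a])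
        moreover have "cmod \<dots> \<le> norm (a i (x n)) * norm (a i (y n))" by (rule norm_cinner_le)
        ultimately show "cmod (cinner (x n) ((((a i)\<^sup>\<dagger> o\<^sub>L a i) - 0) (y n))) \<le> (u n + v n) / 2"
          using sum_squares_bound[of "norm (a i (x n))" "norm (a i (y n))"] by (simp add: u_def v_def)
      qed
      also have "\<dots> = (suminf u + suminf v) / 2"
        by (simp add: suminf_divide[symmetric] suminf_add uv summable_add)
      also have "\<dots> < e" using i unfolding u_def[symmetric] v_def[symmetric] by simp
      finally show "dist (\<Sum>n. cinner (x n) ((((a i)\<^sup>\<dagger> o\<^sub>L a i) - 0) (y n))) 0 < e" by simp
    qed
  qed
qed

text \<open>Weak operator compactness of balls, by Tychonoff's theorem for the matrix coefficients.\<close>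
lemma bounded_operators_weak_cluster_point:
  fixes a :: "nat \<Rightarrow> 'h::chilbert_space \<Rightarrow>\<^sub>L 'h"
  assumes bd: "\<And>n. norm (a n) \<le> C" and a: "\<And>n. a n \<in> cbounded_ops"
  obtains F b where "F \<noteq> bot" "F \<le> sequentially" "b \<in> cbounded_ops" "norm b \<le> C"
    "\<And>x y. ((\<lambda>n. cinner x (a n y)) \<longlongrightarrow> cinner x (blinfun_apply b y)) F"
proof -
  define T where "T n = (\<lambda>(x, y). inner x (a n y))" for n
  define S where "S = (\<lambda>(x :: 'h, y :: 'h). cball (0 :: real) (norm x * (C * norm y)))"
  have C: "0 \<le> C" using bd[of 0] norm_ge_zero order.trans by blast
  have bd': "\<bar>inner x (a n y)\<bar> \<le> norm x * (C * norm y)" for x n y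
    by (meson Cauchy_Schwarz_ineq2 bd mult_left_mono mult_right_mono norm_blinfun norm_ge_zero order.trans)
  have "compactin (product_topology (\<lambda>i. euclidean) UNIV) (PiE UNIV S)"
    by (subst compactin_PiE) (auto simp: S_def split: prod.split)
  then have "compact (PiE UNIV S)" by (simp add: euclidean_product_topology)
  moreover have "T n \<in> PiE UNIV S" for n
    using bd' by (auto simp: T_def S_def)
  ultimately obtain f where f: "inf (nhds f) (filtermap T sequentially) \<noteq> bot"
    unfolding compact_filter by (metis (no_types, lifting) always_eventually eventually_filtermap filtermap_bot_iff sequentially_bot)
  \<comment> \<open>The filter of neighbourhoods of the cluster point, pulled back to indices, takes
    the place of a convergent subnet; it is proper and refines \<open>sequentially\<close>.\<close>
  define F where "F = inf (filtercomap T (nhds f)) sequentially"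
  have F_le: "F \<le> sequentially" by (simp add: F_def)
  have F: "F \<noteq> bot"
  proof
    assume "F = bot"
    then have "eventually (\<lambda>_. False) F" by simp
    then obtain P Q where PQ: "eventually P (filtercomap T (nhds f))" "eventually Q sequentially" "\<And>n. \<not> (P n \<and> Q n)"
      unfolding F_def eventually_inf by auto
    from PQ(1) obtain P' where P': "eventually P' (nhds f)" "\<And>n. P' (T n) \<Longrightarrow> P n"
      unfolding eventually_filtercomap by blast
    have "eventually (\<lambda>g. \<not> P' g) (filtermap T sequentially)"
      unfolding eventually_filtermap using PQ(2) by (rule eventually_mono) (use PQ(3) P' in blast)
    with P'(1) have "eventually (\<lambda>_. False) (inf (nhds f) (filtermap T sequentially))"
      unfolding eventually_inf by blast
    then show False using f by (simp add: eventually_False)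
  qed
  have "filterlim T (nhds f) F"
    by (rule filterlim_mono[OF filterlim_filtercomap order_refl]) (simp add: F_def)
  then have "limitin (product_topology (\<lambda>i. euclidean) UNIV) T f F"
    by (simp add: euclidean_product_topology)
  then have lim: "((\<lambda>n. T n i) \<longlongrightarrow> f i) F" for i
    by (cases i) (simp add: limitin_componentwise)
  define B where "B x y = f (x, y)" for x y
  have limB: "((\<lambda>n. inner x (a n y)) \<longlongrightarrow> B x y) F" for x y
    using lim[of "(x, y)"] by (simp add: T_def B_def)
  note uniq = tendsto_unique[OF F limB]
  have Bbd: "\<bar>B x y\<bar> \<le> norm x * (C * norm y)" for x y
    by (rule tendsto_upperbound[OF tendsto_rabs[OF limB]]) (use bd' F in auto)
  have "bounded_bilinear B"
  proof
    fix x x' y y' and r :: real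
    show "B (x + x') y = B x y + B x' y"
      using tendsto_add[OF limB limB] by (intro uniq) (simp add: inner_add_left)
    show "B x (y + y') = B x y + B x y'"
      using tendsto_add[OF limB limB] by (intro uniq) (simp add: inner_add_right blinfun.add_right)
    show "B (r *\<^sub>R x) y = r *\<^sub>R B x y"
      using tendsto_mult[OF tendsto_const limB] by (intro uniq) simp
    show "B x (r *\<^sub>R y) = r *\<^sub>R B x y"
      using tendsto_mult[OF tendsto_const limB] by (intro uniq) (simp add: blinfun.scaleR_right)
    show "\<exists>K. \<forall>x y. norm (B x y) \<le> norm x * norm y * K"
      by (rule exI[of _ C]) (use Bbd in \<open>simp add: mult_ac\<close>)
  qed
  then obtain b :: "'h \<Rightarrow>\<^sub>L 'h" where b: "\<And>x y. inner x (b y) = B x y"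
    using bounded_form_represented[of B] by blast
  have clim: "((\<lambda>n. cinner x (a n y)) \<longlongrightarrow> cinner x (b y)) F" for x y
    unfolding cinner_conv_inner b by (intro tendsto_Complex limB)
  have "b \<in> cbounded_ops"
  proof (rule cbounded_opsI, rule cinner_ext)
    fix c x y
    have "((\<lambda>n. c * cinner x (a n y)) \<longlongrightarrow> c * cinner x (b y)) F"
      by (intro tendsto_intros clim)
    then have "((\<lambda>n. cinner x (a n (c *\<^sub>C y))) \<longlongrightarrow> c * cinner x (b y)) F"
      by (simp add: cbounded_opsD[OF a] cinner_scaleC_right)
    then show "cinner x (b (c *\<^sub>C y)) = cinner x (c *\<^sub>C b y)"
      using tendsto_unique[OF F clim] by (simp add: cinner_scaleC_right)
  qed
  moreover have "norm b \<le> C"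
  proof (rule norm_blinfun_bound[OF C])
    fix y
    have "norm (b y) * norm (b y) \<le> norm (b y) * (C * norm y)"
      using Bbd[of "b y" y] by (simp add: b[symmetric] dot_square_norm power2_eq_square)
    then show "norm (b y) \<le> C * norm y" using C by (cases "b y = 0") auto
  qed
  ultimately show thesis using that F F_le clim by blast
qed

section \<open>Strong limits of \<open>T\<^sup>*\<^sup>n T\<^sup>n\<close> for a contraction \<open>T\<close>\<close>

lemma op_power_apply_commute: "op_power T n (T x) = T (op_power T n x)"
  by (induction n) auto

lemma op_power_contraction:
  assumes "norm T \<le> 1"
  shows "norm (op_power T n x) \<le> norm x" "norm (op_power T n) \<le> 1"
proof -
  show *: "norm (op_power T n x) \<le> norm x" for x
  proof (induction n)
    case (Suc n)
    have "norm (T (op_power T n x)) \<le> norm T * norm (op_power T n x)" by (rule norm_blinfun)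
    also have "\<dots> \<le> 1 * norm x" using assms Suc by (intro mult_mono) auto
    finally show ?case by simp
  qed simp
  show "norm (op_power T n) \<le> 1" by (rule norm_blinfun_bound) (use * in auto)
qed

lemma op_power_decreasing:
  assumes "norm T \<le> 1" "m \<le> n"
  shows "norm (op_power T n x) \<le> norm (op_power T m x)"
  using assms(2)
proof (induction n rule: dec_induct)
  case (step n)
  have "norm (T (op_power T n x)) \<le> norm T * norm (op_power T n x)" by (rule norm_blinfun)
  also have "\<dots> \<le> 1 * norm (op_power T n x)" using assms by (intro mult_right_mono) auto
  finally show ?case using step by simp
qed simp

lemma op_power_in_cbounded_ops: "T \<in> cbounded_ops \<Longrightarrow> op_power T n \<in> cbounded_ops"
  by (induction n) (auto intro!: cbounded_opsI simp: cbounded_opsD)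

lemma cinner_op_power_cadjoint:
  assumes T: "T \<in> cbounded_ops"
  shows "cinner x (op_power (T\<^sup>\<dagger>) n y) = cinner (op_power T n x) y"
proof (induction n arbitrary: x)
  case (Suc n)
  then show ?case by (simp add: cinner_cadjoint_right[OF T] op_power_apply_commute)
qed simp

lemma inner_V_plus_seq:
  assumes T: "T \<in> cbounded_ops"
  shows "inner x (V_plus_seq T n y) = inner (op_power T n x) (op_power T n y)"
  by (simp add: V_plus_seq_def inner_eq_Re_cinner cinner_op_power_cadjoint[OF T])

text \<open>The difference of the two operators lies between 0 and 1 because the norms of the
  iterates decrease, so its squared action is bounded by its quadratic form. Thus strong convergence
  reduces to convergence of a decreasing scalar sequence.\<close>

lemma V_plus_seq_diff_le:
  assumes T: "T \<in> cbounded_ops" "norm T \<le> 1" and mn: "m \<le> n"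
  shows "(norm (V_plus_seq T m x - V_plus_seq T n x))\<^sup>2 \<le> (norm (op_power T m x))\<^sup>2 - (norm (op_power T n x))\<^sup>2"
proof -
  define B where "B = V_plus_seq T m - V_plus_seq T n"
  have B: "inner u (B v) = inner (op_power T m u) (op_power T m v) - inner (op_power T n u) (op_power T n v)" for u v
    by (simp add: B_def blinfun.diff_left inner_diff_right inner_V_plus_seq[OF T(1)])
  have "(norm (B x))\<^sup>2 \<le> inner x (B x)"
  proof (rule norm_apply_sq_le_quadratic_form)
    show "inner (B u) v = inner u (B v)" for u v
      using B[of u v] B[of v u] by (simp add: inner_commute)
    have "(norm (op_power T n u))\<^sup>2 \<le> (norm (op_power T m u))\<^sup>2" for u
      by (intro power_mono op_power_decreasing T mn) simp
    then show "0 \<le> inner u (B u)" for u by (simp add: B dot_square_norm)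
    have "(norm (op_power T m u))\<^sup>2 \<le> (norm u)\<^sup>2" for u
      by (intro power_mono op_power_contraction T) simp
    then have "(norm (op_power T m u))\<^sup>2 - (norm (op_power T n u))\<^sup>2 \<le> (norm u)\<^sup>2" for u
      by (rule order.trans[OF diff_left_mono[OF zero_le_power2, unfolded diff_zero]])
    then show "inner u (B u) \<le> inner u u" for u
      by (simp add: B dot_square_norm)
  qed
  then show ?thesis by (simp add: B dot_square_norm) (simp add: B_def blinfun.diff_left)
qed

text \<open>Stated for an arbitrary contraction, as it is applied to \<open>U\<close>, to its
  adjoint and to a symmetric product of the two resulting limits. The fixed vectors of the limit are
  those on which every power of \<open>T\<close> is isometric.\<close>

lemma V_plus_seq_limit:
  assumes T: "T \<in> cbounded_ops" "norm T \<le> 1"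
  defines "L \<equiv> sot_lim (V_plus_seq T)"
  shows "norm L \<le> 1" "\<And>x. (\<lambda>n. V_plus_seq T n x) \<longlonglongrightarrow> L x" "L \<in> cbounded_ops"
    "\<And>x y. inner (L x) y = inner x (L y)"
    "\<And>x. L x = x \<longleftrightarrow> (\<forall>n. norm (op_power T n x) = norm x)"
    "\<And>x. norm (L x) = norm x \<Longrightarrow> L x = x"
    "\<And>x. (\<lambda>n. op_power T n x) \<longlonglongrightarrow> 0 \<Longrightarrow> L x = 0"
proof -
  have bound: "norm (V_plus_seq T n) \<le> 1" for n
    using norm_blinfun_compose_le_mult[OF op_power_contraction(2) op_power_contraction(2), of "T\<^sup>\<dagger>" T n n]
      norm_cadjoint_le[OF T(1)] T(2) by (simp add: V_plus_seq_def)
  have "convergent (\<lambda>n. V_plus_seq T n x)" for x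
  proof -
    define s where "s n = (norm (op_power T n x))\<^sup>2" for n
    have "decseq s" unfolding s_def decseq_def
      by (intro allI impI power_mono op_power_decreasing T) auto
    then obtain l where "s \<longlonglongrightarrow> l"
      using decseq_convergent[of s 0] by (auto simp: s_def)
    then have "convergent s" by (rule convergentI)
    then have cs: "Cauchy s" by (simp add: Cauchy_convergent_iff)
    have "Cauchy (\<lambda>n. V_plus_seq T n x)"
    proof (rule metric_CauchyI)
      fix e :: real assume e: "e > 0"
      then obtain N where N: "\<And>m n. m \<ge> N \<Longrightarrow> n \<ge> N \<Longrightarrow> dist (s m) (s n) < e\<^sup>2"
        using metric_CauchyD[OF cs, of "e\<^sup>2"] by auto
      have *: "dist (V_plus_seq T m x) (V_plus_seq T n x) < e" if "N \<le> m" "m \<le> n" for m n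
      proof -
        have "(norm (V_plus_seq T m x - V_plus_seq T n x))\<^sup>2 \<le> s m - s n"
          unfolding s_def by (rule V_plus_seq_diff_le[OF T that(2)])
        also have "\<dots> < e\<^sup>2" using N[of m n] that by (simp add: dist_real_def)
        finally show ?thesis using e by (simp add: dist_norm power2_less_imp_less)
      qed
      have "dist (V_plus_seq T m x) (V_plus_seq T n x) < e" if "N \<le> m" "N \<le> n" for m n
        using *[of m n] *[of n m] that by (cases "m \<le> n") (auto simp: dist_commute)
      then show "\<exists>N. \<forall>m\<ge>N. \<forall>n\<ge>N. dist (V_plus_seq T m x) (V_plus_seq T n x) < e" by blast
    qed
    then show ?thesis by (simp add: Cauchy_convergent_iff)
  qed
  from strong_limit_exists[OF bound this] obtain V
    where V: "norm V \<le> 1" "\<And>x. (\<lambda>n. V_plus_seq T n x) \<longlonglongrightarrow> blinfun_apply V x" by blast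
  have L: "L = V" unfolding L_def by (rule sot_lim_eqI[OF V(2)])
  have form: "(\<lambda>n. inner (op_power T n x) (op_power T n y)) \<longlonglongrightarrow> inner x (V y)" for x y
    using tendsto_inner[OF tendsto_const V(2)] by (simp add: inner_V_plus_seq[OF T(1)])
  have sq: "(\<lambda>n. (norm (op_power T n x))\<^sup>2) \<longlonglongrightarrow> inner x (V x)" for x
    using form[of x x] by (simp add: dot_square_norm)
  have sym: "inner (V x) y = inner x (V y)" for x y
    using LIMSEQ_unique[OF form[of x y]] form[of y x] by (simp add: inner_commute)
  have le: "(norm (V x))\<^sup>2 \<le> inner x (V x)" for x
  proof (rule norm_apply_sq_le_quadratic_form[OF sym])
    show "0 \<le> inner u (V u)" for u by (rule LIMSEQ_le_const[OF sq]) auto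
    show "inner u (V u) \<le> inner u u" for u
      by (rule LIMSEQ_le_const2[OF sq]) (auto simp: dot_square_norm intro!: power_mono op_power_contraction T)
  qed
  \<comment> \<open>Since \<open>inner x (V x)\<close> is at least the squared norm of
    \<open>V x\<close>, the squared distance from \<open>V x\<close> to \<open>x\<close> is at most
    the squared norm of \<open>x\<close> minus that of \<open>V x\<close>.\<close>
  have fixed: "V x = x" if "norm (V x) = norm x" for x
  proof -
    have "(norm (V x - x))\<^sup>2 = (norm (V x))\<^sup>2 - 2 * inner x (V x) + (norm x)\<^sup>2"
      by (simp add: dot_square_norm[symmetric] inner_simps inner_commute)
    also have "\<dots> \<le> 0" using le[of x] that by simp
    finally show ?thesis by simp
  qed
  have Vop: "V \<in> cbounded_ops"
  proof (rule cbounded_opsI)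
    fix c x
    have "V_plus_seq T n \<in> cbounded_ops" for n
      by (intro cbounded_opsI) (simp add: V_plus_seq_def cbounded_opsD op_power_in_cbounded_ops cadjoint_in_cbounded_ops T)
    then have "(\<lambda>n. V_plus_seq T n (c *\<^sub>C x)) \<longlonglongrightarrow> c *\<^sub>C V x"
      using bounded_linear.tendsto[OF bounded_linear_scaleC V(2)] by (simp add: cbounded_opsD)
    then show "V (c *\<^sub>C x) = c *\<^sub>C V x" using LIMSEQ_unique V(2) by blast
  qed
  show "norm L \<le> 1" "\<And>x. (\<lambda>n. V_plus_seq T n x) \<longlonglongrightarrow> L x" "L \<in> cbounded_ops"
    "\<And>x y. inner (L x) y = inner x (L y)" "\<And>x. norm (L x) = norm x \<Longrightarrow> L x = x"
    unfolding L by (rule V Vop sym fixed; assumption)+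
  show "L x = x \<longleftrightarrow> (\<forall>n. norm (op_power T n x) = norm x)" for x
    unfolding L
  proof
    assume eq: "V x = x"
    show "\<forall>n. norm (op_power T n x) = norm x"
    proof
      fix n
      \<comment> \<open>A decreasing sequence stays above its limit, which is the squared norm of
        \<open>x\<close> when \<open>V x = x\<close>.\<close>
      have "inner x (V x) \<le> (norm (op_power T n x))\<^sup>2"
        using T by (intro LIMSEQ_le_const2[OF sq]) (auto intro!: exI[of _ n] power_mono op_power_decreasing)
      then have "norm x \<le> norm (op_power T n x)"
        unfolding eq dot_square_norm by (rule power2_le_imp_le) simp
      with op_power_contraction(1)[OF T(2), of n x] show "norm (op_power T n x) = norm x"
        by (rule order.antisym)
    qed
  next
    assume eq: "\<forall>n. norm (op_power T n x) = norm x"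
    \<comment> \<open>With \<open>m = 0\<close> the right-hand side of the increment estimate is
      zero.\<close>
    have "V_plus_seq T n x = x" for n
      using V_plus_seq_diff_le[OF T, of 0 n x] eq by (simp add: V_plus_seq_def)
    then show "V x = x" using LIMSEQ_unique[OF V(2)[of x]] by simp
  qed
  show "L x = 0" if "(\<lambda>n. op_power T n x) \<longlonglongrightarrow> 0" for x
    unfolding L
  proof (rule LIMSEQ_unique[OF V(2)])
    have "norm (V_plus_seq T n x) \<le> norm (op_power T n x)" for n
      using op_power_contraction(1)[of "T\<^sup>\<dagger>" n "op_power T n x"] norm_cadjoint_le[OF T(1)] T(2)
      by (simp add: V_plus_seq_def)
    then show "(\<lambda>n. V_plus_seq T n x) \<longlonglongrightarrow> 0"
      by (intro Lim_null_comparison[OF always_eventually tendsto_norm_zero[OF that]]) auto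
  qed
qed

section \<open>The GNS representation of a normal faithful state\<close>

text \<open>Not increasing norms on a subspace makes the linear map \<open>h\<close> uniformly
  continuous, so it extends to the closure; linearity and the bound pass to limits. Provides the
  existence of the GNS contraction.\<close>

lemma contraction_extension:
  fixes T :: "'k::chilbert_space set" and h :: "'k \<Rightarrow> 'k"
  assumes T: "closure T = UNIV" "\<And>x y. x \<in> T \<Longrightarrow> y \<in> T \<Longrightarrow> x + y \<in> T" "\<And>c x. x \<in> T \<Longrightarrow> c *\<^sub>C x \<in> T"
    and h: "clinear_on T h" "\<And>x. x \<in> T \<Longrightarrow> norm (h x) \<le> norm x"
  obtains U where "U \<in> cbounded_ops" "norm U \<le> 1" "\<And>x. x \<in> T \<Longrightarrow> blinfun_apply U x = h x"
proof -
  have "dist (h x) (h y) \<le> dist x y" if "x \<in> T" "y \<in> T" for x y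
  proof -
    have m: "(- 1) *\<^sub>C y \<in> T" by (rule T(3)[OF that(2)])
    then have "x - y \<in> T" using T(2)[OF that(1) m] by (simp add: scaleC_minus_one)
    then have "norm (h (x - y)) \<le> norm (x - y)" by (rule h(2))
    then show ?thesis using clinear_onD(4)[OF h(1) that m] by (simp add: dist_norm)
  qed
  then have uc: "uniformly_continuous_on T h"
    unfolding uniformly_continuous_on_def by (meson order.strict_trans1)
  have "\<exists>g. uniformly_continuous_on (closure T) g \<and> (\<forall>x\<in>T. h x = g x)"
  proof (rule uniformly_continuous_on_extension_on_closure[OF uc])
    fix g assume "uniformly_continuous_on (closure T) g" "\<And>x. x \<in> T \<Longrightarrow> h x = g x"
    then show ?thesis by blast
  qed
  then obtain g where "uniformly_continuous_on (closure T) g" and g: "\<And>x. x \<in> T \<Longrightarrow> h x = g x"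
    by blast
  then have "continuous_on UNIV g" by (simp add: T(1) uniformly_continuous_imp_continuous)
  then have cont: "(\<lambda>n. g (s n)) \<longlonglongrightarrow> g x" if "s \<longlonglongrightarrow> x" for s :: "nat \<Rightarrow> 'k" and x
    using that by (rule continuous_on_tendsto_compose) auto
  have approx: "\<exists>s. (\<forall>n. s n \<in> T) \<and> s \<longlonglongrightarrow> x" for x
    using T(1) closure_sequential[of x T] by auto
  have add: "g (x + y) = g x + g y" for x y
  proof -
    obtain s t where s: "\<And>n. s n \<in> T" "s \<longlonglongrightarrow> x" and t: "\<And>n. t n \<in> T" "t \<longlonglongrightarrow> y"
      using approx by meson
    have "(\<lambda>n. g (s n + t n)) \<longlonglongrightarrow> g x + g y"
      using tendsto_add[OF cont[OF s(2)] cont[OF t(2)]] clinear_onD(1)[OF h(1) s(1) t(1)]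
      by (simp add: g s t T)
    then show ?thesis using LIMSEQ_unique cont[OF tendsto_add[OF s(2) t(2)]] by blast
  qed
  have scale: "g (c *\<^sub>C x) = c *\<^sub>C g x" for c x
  proof -
    obtain s where s: "\<And>n. s n \<in> T" "s \<longlonglongrightarrow> x" using approx by meson
    have "(\<lambda>n. g (c *\<^sub>C s n)) \<longlonglongrightarrow> c *\<^sub>C g x"
      using bounded_linear.tendsto[OF bounded_linear_scaleC cont[OF s(2)]] clinear_onD(2)[OF h(1) s(1)]
      by (simp add: g s T)
    then show ?thesis
      using LIMSEQ_unique cont[OF bounded_linear.tendsto[OF bounded_linear_scaleC s(2)]] by blast
  qed
  have bound: "norm (g x) \<le> norm x" for x
  proof -
    obtain s where s: "\<And>n. s n \<in> T" "s \<longlonglongrightarrow> x" using approx by meson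
    show ?thesis
      by (rule LIMSEQ_le[OF tendsto_norm[OF cont[OF s(2)]] tendsto_norm[OF s(2)]])
        (use h(2)[OF s(1)] g[OF s(1)] in auto)
  qed
  have "bounded_linear g"
    using scale[of "complex_of_real _"] add bound
    by (intro bounded_linear_intro[where K = 1]) (auto simp: scaleC_of_real)
  then have U: "blinfun_apply (Blinfun g) x = g x" for x by (simp add: bounded_linear_Blinfun_apply)
  show thesis
  proof (rule that)
    show "Blinfun g \<in> cbounded_ops" by (rule cbounded_opsI) (simp add: U scale)
    show "norm (Blinfun g) \<le> 1" by (rule norm_blinfun_bound) (simp_all add: U bound)
  qed (simp add: U g)
qed

locale gns_state =
  fixes M :: "('h::chilbert_space \<Rightarrow>\<^sub>L 'h) set" and \<phi> :: "('h \<Rightarrow>\<^sub>L 'h) \<Rightarrow> complex"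
    and \<pi> :: "('h \<Rightarrow>\<^sub>L 'h) \<Rightarrow> ('k::chilbert_space \<Rightarrow>\<^sub>L 'k)" and \<Omega> :: 'k
  assumes vN: "von_neumann_algebra M" and state: "normal_faithful_state M \<phi>"
    and gns: "gns_representation M \<phi> \<pi> \<Omega>"
begin

abbreviation vec :: "('h \<Rightarrow>\<^sub>L 'h) \<Rightarrow> 'k" where "vec a \<equiv> blinfun_apply (\<pi> a) \<Omega>"

lemmas M_star = von_neumann_algebraD(1)[OF vN] and M_closed = von_neumann_algebraD(2)[OF vN]
lemmas M_cb = star_subalgebra_cbounded[OF M_star] and M_id = star_subalgebra_id[OF M_star]
  and M_intros = star_subalgebra_closed[OF M_star]

lemma state_linear: "clinear_on M \<phi>"
  using state by (simp add: normal_faithful_state_def)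

lemmas state_simps = clinear_onD[OF state_linear]

lemma state_square_nonneg: "a \<in> M \<Longrightarrow> \<phi> (a\<^sup>\<dagger> o\<^sub>L a) \<in> \<real>\<^sub>\<ge>\<^sub>0"
  and state_faithful: "a \<in> M \<Longrightarrow> \<phi> (a\<^sup>\<dagger> o\<^sub>L a) = 0 \<Longrightarrow> a = 0"
  and state_normal: "continuous_map (subtopology ultraweak_topology M) euclidean \<phi>"
  using state by (auto simp: normal_faithful_state_def)

lemma state_positive: "p \<in> M \<Longrightarrow> op_le 0 p \<Longrightarrow> \<phi> p \<in> \<real>\<^sub>\<ge>\<^sub>0"
  by (rule positive_functional_nonneg[OF M_star M_closed state_linear state_square_nonneg])

text \<open>Faithfulness is assumed for squares only. From \<open>0 <= x <= K\<close> follows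
  \<open>x^2 <= K x\<close>, so the state vanishes on \<open>x^2\<close> once it vanishes on
  \<open>x\<close>.\<close>

lemma state_faithful_positive:
  assumes x: "x \<in> M" "op_le 0 x" and zero: "\<phi> x = 0"
  shows "x = 0"
proof (rule state_faithful[OF x(1)])
  \<comment> \<open>The summand 1 allows division by \<open>K\<close> also when
    \<open>x = 0\<close>.\<close>
  define K where "K = norm x + 1"
  have K: "0 < K" "norm x \<le> K" by (auto simp: K_def add_nonneg_pos)
  define B where "B = (1 / K) *\<^sub>R x"
  note xc = M_cb[OF x(1)]
  have sa: "x\<^sup>\<dagger> = x" by (rule positive_selfadjoint[OF xc x(2)])
  have KB: "x y = K *\<^sub>R B y" for y using K by (simp add: B_def blinfun.scaleR_left)
  have le: "(norm (B y))\<^sup>2 \<le> inner y (B y)" for y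
  proof (rule norm_apply_sq_le_quadratic_form)
    show "inner (B u) v = inner u (B v)" for u v
      using sa selfadjoint_iff_inner[OF xc] by (simp add: B_def blinfun.scaleR_left)
    show "0 \<le> inner u (B u)" for u
      using op_le_inner[OF x(2), of u] K by (simp add: B_def blinfun.scaleR_left)
    show "inner u (B u) \<le> inner u u" for u
    proof -
      have "inner u (x u) \<le> norm u * (norm x * norm u)"
        by (meson mult_left_mono norm_blinfun norm_cauchy_schwarz norm_ge_zero order.trans)
      also have "\<dots> \<le> norm u * (K * norm u)"
        using K by (intro mult_left_mono mult_right_mono) auto
      finally show ?thesis
        using K by (simp add: B_def blinfun.scaleR_left dot_square_norm power2_eq_square field_simps)
    qed
  qed
  have "op_le 0 (K *\<^sub>R x - (x\<^sup>\<dagger> o\<^sub>L x))"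
    unfolding op_le_zero_iff
  proof
    fix y
    have 1: "cinner y (x y) = inner y (x y)"
      using x(2) by (simp add: op_le_zero_iff complex_eq_iff inner_eq_Re_cinner complex_nonneg_Reals_iff)
    have "(norm (x y))\<^sup>2 = K\<^sup>2 * (norm (B y))\<^sup>2" using K by (simp add: KB power_mult_distrib)
    also have "\<dots> \<le> K\<^sup>2 * inner y (B y)" by (intro mult_left_mono le) simp
    also have "\<dots> = K * inner y (x y)" by (simp add: KB power2_eq_square)
    finally have "(norm (x y))\<^sup>2 \<le> K * inner y (x y)" .
    then show "cinner y ((K *\<^sub>R x - (x\<^sup>\<dagger> o\<^sub>L x)) y) \<in> \<real>\<^sub>\<ge>\<^sub>0"
      by (simp add: blinfun.diff_left blinfun.scaleR_left cinner.diff_right cinner.scaleR_right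
          cinner_cadjoint_right[OF xc] cinner_self 1 complex_nonneg_Reals_iff del: of_real_power)
  qed
  then have "\<phi> (K *\<^sub>R x - (x\<^sup>\<dagger> o\<^sub>L x)) \<in> \<real>\<^sub>\<ge>\<^sub>0"
    using x by (intro state_positive M_intros)
  also have "\<phi> (K *\<^sub>R x - (x\<^sup>\<dagger> o\<^sub>L x)) = - \<phi> (x\<^sup>\<dagger> o\<^sub>L x)"
    using x by (simp add: state_simps M_intros zero)
  finally show "\<phi> (x\<^sup>\<dagger> o\<^sub>L x) = 0"
    using state_square_nonneg[OF x(1)] by (simp add: complex_nonneg_Reals_iff complex_eq_iff)
qed

section \<open>The dense subspace of vectors coming from the algebra\<close>

lemma dense: "closure (vec ` M) = UNIV"
  using gns by (simp add: gns_representation_def)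

lemma vec_add: "a \<in> M \<Longrightarrow> b \<in> M \<Longrightarrow> vec (a + b) = vec a + vec b"
  and vec_scaleC: "a \<in> M \<Longrightarrow> vec (c *\<^sub>C a) = c *\<^sub>C vec a"
  and vec_diff: "a \<in> M \<Longrightarrow> b \<in> M \<Longrightarrow> vec (a - b) = vec a - vec b"
proof -
  have lin: "clinear_on M \<pi>" using gns by (simp add: gns_representation_def)
  note l = clinear_onD[OF lin]
  show "vec (a + b) = vec a + vec b" if "a \<in> M" "b \<in> M"
    using l(1)[OF that] by (simp add: blinfun.add_left)
  show "vec (c *\<^sub>C a) = c *\<^sub>C vec a" if "a \<in> M"
    using l(2)[OF that] by (simp add: blinfun_apply_scaleC)
  show "vec (a - b) = vec a - vec b" if "a \<in> M" "b \<in> M"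
    using l(4)[OF that M_intros(2)[OF that(2)]] by (simp add: blinfun.diff_left)
qed

lemma cinner_vec:
  assumes "a \<in> M" "b \<in> M"
  shows "cinner (vec a) (vec b) = \<phi> (a\<^sup>\<dagger> o\<^sub>L b)"
proof -
  have ad: "a\<^sup>\<dagger> \<in> M" using assms by (intro M_intros)
  have "\<pi> a \<in> cbounded_ops" using gns assms by (simp add: gns_representation_def)
  then have "cinner (vec a) (vec b) = cinner \<Omega> (((\<pi> a)\<^sup>\<dagger>) (vec b))"
    by (simp add: cinner_cadjoint_right)
  also have "\<dots> = cinner \<Omega> (vec (a\<^sup>\<dagger> o\<^sub>L b))"
    using gns assms ad by (simp add: gns_representation_def)
  also have "\<dots> = \<phi> (a\<^sup>\<dagger> o\<^sub>L b)"
    using gns M_intros(5)[OF ad assms(2)] by (simp add: gns_representation_def)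
  finally show ?thesis .
qed

lemma norm_vec: "a \<in> M \<Longrightarrow> (norm (vec a))\<^sup>2 = Re (\<phi> (a\<^sup>\<dagger> o\<^sub>L a))"
  by (simp add: inner_eq_Re_cinner cinner_vec flip: dot_square_norm)

text \<open>Faithfulness makes the cyclic vector separating, so a map of the algebra induces a
  well-defined map of vectors.\<close>

lemma vec_inj: "inj_on vec M"
proof (rule inj_onI)
  fix a b assume ab: "a \<in> M" "b \<in> M" "vec a = vec b"
  then have d: "a - b \<in> M" "vec (a - b) = 0" by (simp_all add: M_intros vec_diff)
  then have "\<phi> ((a - b)\<^sup>\<dagger> o\<^sub>L (a - b)) = 0" using cinner_vec[OF d(1) d(1)] by (simp add: cinner.zero_right)
  then show "a = b" using state_faithful[OF d(1)] by simp
qed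

lemma eq_if_cinner_vec_eq:
  assumes "\<And>c. c \<in> M \<Longrightarrow> cinner (vec c) x = cinner (vec c) y"
  shows "x = y"
proof -
  have "closed {z. cinner z x = cinner z y}"
    by (intro closed_Collect_eq cinner.continuous_on continuous_intros)
  then have "closure (vec ` M) \<subseteq> {z. cinner z x = cinner z y}"
    using assms by (intro closure_minimal) auto
  then show ?thesis unfolding dense by - (rule cinner_ext, auto)
qed

lemma eq_if_eq_on_vec:
  assumes "\<And>c. c \<in> M \<Longrightarrow> blinfun_apply A (vec c) = blinfun_apply B (vec c)"
  shows "A = B"
proof -
  have "closed {z. blinfun_apply A z = blinfun_apply B z}"
    by (intro closed_Collect_eq continuous_intros)
  then have "closure (vec ` M) \<subseteq> {z. blinfun_apply A z = blinfun_apply B z}"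
    using assms by (intro closure_minimal) auto
  then show ?thesis unfolding dense by (intro blinfun_eqI) auto
qed

subsection \<open>State-preserving Schwartz maps\<close>

lemma schwartz_defect_positive:
  assumes "unital_schwartz_map M \<Psi>" "a \<in> M"
  shows "\<Psi> (a\<^sup>\<dagger> o\<^sub>L a) - (\<Psi> (a\<^sup>\<dagger>) o\<^sub>L \<Psi> a) \<in> M" "op_le 0 (\<Psi> (a\<^sup>\<dagger> o\<^sub>L a) - (\<Psi> (a\<^sup>\<dagger>) o\<^sub>L \<Psi> a))"
proof -
  show "\<Psi> (a\<^sup>\<dagger> o\<^sub>L a) - (\<Psi> (a\<^sup>\<dagger>) o\<^sub>L \<Psi> a) \<in> M"
    by (intro M_intros unital_schwartz_mapD(1)[OF assms(1)] assms(2))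
  show "op_le 0 (\<Psi> (a\<^sup>\<dagger> o\<^sub>L a) - (\<Psi> (a\<^sup>\<dagger>) o\<^sub>L \<Psi> a))"
    using unital_schwartz_mapD(5)[OF assms] by (simp add: op_le_zero_diff)
qed

text \<open>Invariance of the state turns the expectation of the positive Schwartz defect into the
  loss of squared GNS norm.\<close>

lemma state_schwartz_defect:
  assumes S: "unital_schwartz_map M \<Psi>" and inv: "\<And>a. a \<in> M \<Longrightarrow> \<phi> (\<Psi> a) = \<phi> a" and a: "a \<in> M"
  shows "Re (\<phi> (\<Psi> (a\<^sup>\<dagger> o\<^sub>L a) - (\<Psi> (a\<^sup>\<dagger>) o\<^sub>L \<Psi> a))) = (norm (vec a))\<^sup>2 - (norm (vec (\<Psi> a)))\<^sup>2"
proof -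
  have m: "\<Psi> (a\<^sup>\<dagger> o\<^sub>L a) \<in> M" "\<Psi> (a\<^sup>\<dagger>) o\<^sub>L \<Psi> a \<in> M" "\<Psi> a \<in> M"
    by (intro M_intros unital_schwartz_mapD(1)[OF S] a)+
  have "\<phi> (\<Psi> (a\<^sup>\<dagger> o\<^sub>L a) - (\<Psi> (a\<^sup>\<dagger>) o\<^sub>L \<Psi> a)) = \<phi> (a\<^sup>\<dagger> o\<^sub>L a) - \<phi> ((\<Psi> a)\<^sup>\<dagger> o\<^sub>L \<Psi> a)"
    using m a by (simp add: state_simps M_intros inv schwartz_map_cadjoint[OF M_star M_closed S])
  then show ?thesis using m a by (simp add: norm_vec)
qed

lemma norm_vec_schwartz_le:
  assumes S: "unital_schwartz_map M \<Psi>" and inv: "\<And>a. a \<in> M \<Longrightarrow> \<phi> (\<Psi> a) = \<phi> a" and a: "a \<in> M"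
  shows "norm (vec (\<Psi> a)) \<le> norm (vec a)"
proof -
  have "0 \<le> Re (\<phi> (\<Psi> (a\<^sup>\<dagger> o\<^sub>L a) - (\<Psi> (a\<^sup>\<dagger>) o\<^sub>L \<Psi> a)))"
    using state_positive[OF schwartz_defect_positive[OF S a]] by (simp add: complex_nonneg_Reals_iff)
  then have "(norm (vec (\<Psi> a)))\<^sup>2 \<le> (norm (vec a))\<^sup>2"
    using state_schwartz_defect[OF S inv a] by linarith
  then show ?thesis by (rule power2_le_imp_le) simp
qed

text \<open>The bridge from Hilbert space geometry back to algebra: if no norm is lost, the positive
  defect has expectation zero and vanishes by faithfulness.\<close>

lemma norm_vec_schwartz_eq_iff:
  assumes S: "unital_schwartz_map M \<Psi>" and inv: "\<And>a. a \<in> M \<Longrightarrow> \<phi> (\<Psi> a) = \<phi> a" and a: "a \<in> M"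
  shows "norm (vec (\<Psi> a)) = norm (vec a) \<longleftrightarrow> \<Psi> (a\<^sup>\<dagger> o\<^sub>L a) = \<Psi> (a\<^sup>\<dagger>) o\<^sub>L \<Psi> a"
proof
  assume "norm (vec (\<Psi> a)) = norm (vec a)"
  then have "Re (\<phi> (\<Psi> (a\<^sup>\<dagger> o\<^sub>L a) - (\<Psi> (a\<^sup>\<dagger>) o\<^sub>L \<Psi> a))) = 0"
    using state_schwartz_defect[OF S inv a] by simp
  then have "\<phi> (\<Psi> (a\<^sup>\<dagger> o\<^sub>L a) - (\<Psi> (a\<^sup>\<dagger>) o\<^sub>L \<Psi> a)) = 0"
    using state_positive[OF schwartz_defect_positive[OF S a]]
    by (simp add: complex_nonneg_Reals_iff complex_eq_iff)
  then show "\<Psi> (a\<^sup>\<dagger> o\<^sub>L a) = \<Psi> (a\<^sup>\<dagger>) o\<^sub>L \<Psi> a"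
    using state_faithful_positive[OF schwartz_defect_positive[OF S a]] by simp
next
  assume "\<Psi> (a\<^sup>\<dagger> o\<^sub>L a) = \<Psi> (a\<^sup>\<dagger>) o\<^sub>L \<Psi> a"
  moreover have "\<phi> (0 :: 'h \<Rightarrow>\<^sub>L 'h) = 0"
    using state_simps(3)[OF M_id, of 0] by simp
  ultimately have "(norm (vec (\<Psi> a)))\<^sup>2 = (norm (vec a))\<^sup>2"
    using state_schwartz_defect[OF S inv a] by simp
  then show "norm (vec (\<Psi> a)) = norm (vec a)" by (simp add: power2_eq_iff_nonneg)
qed

text \<open>The two multiplicativity equations are the norm criterion at \<open>a\<close> and at its
  adjoint.\<close>

lemma mult_domain_iff:
  assumes S: "unital_schwartz_map M \<Psi>" and inv: "\<And>a. a \<in> M \<Longrightarrow> \<phi> (\<Psi> a) = \<phi> a"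
  shows "a \<in> mult_domain M \<Psi> \<longleftrightarrow>
    a \<in> M \<and> norm (vec (\<Psi> a)) = norm (vec a) \<and> norm (vec (\<Psi> (a\<^sup>\<dagger>))) = norm (vec (a\<^sup>\<dagger>))"
proof (cases "a \<in> M")
  case True
  then have "a\<^sup>\<dagger> \<in> M" by (rule M_intros)
  from norm_vec_schwartz_eq_iff[OF S inv True] norm_vec_schwartz_eq_iff[OF S inv this] True
  show ?thesis by (simp add: mult_domain_def cadjoint_cadjoint[OF M_cb])
qed (simp add: mult_domain_def)

lemma gns_contraction_properties:
  assumes S: "unital_schwartz_map M \<Psi>" and inv: "\<And>a. a \<in> M \<Longrightarrow> \<phi> (\<Psi> a) = \<phi> a"
  defines "U \<equiv> gns_contraction M \<Psi> \<pi> \<Omega>"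
  shows "U \<in> cbounded_ops" "norm U \<le> 1" "\<And>a. a \<in> M \<Longrightarrow> U (vec a) = vec (\<Psi> a)"
proof -
  \<comment> \<open>\<open>inv_into\<close> recovers the unique algebra element behind a
    vector.\<close>
  define h where "h x = vec (\<Psi> (inv_into M vec x))" for x
  have h: "h (vec a) = vec (\<Psi> a)" if "a \<in> M" for a
    using that by (simp add: h_def inv_into_f_f[OF vec_inj])
  note lin = clinear_onD[OF unital_schwartz_mapD(2)[OF S]]
  note im = unital_schwartz_mapD(1)[OF S]
  obtain W where W: "W \<in> cbounded_ops" "norm W \<le> 1" "\<And>x. x \<in> vec ` M \<Longrightarrow> W x = h x"
  proof (rule contraction_extension[OF dense, of h])
    show "x + y \<in> vec ` M" if "x \<in> vec ` M" "y \<in> vec ` M" for x y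
      using that by (auto simp: vec_add[symmetric] intro: M_intros)
    show "c *\<^sub>C x \<in> vec ` M" if "x \<in> vec ` M" for c x
      using that by (auto simp: vec_scaleC[symmetric] intro: M_intros)
    show "norm (h x) \<le> norm x" if "x \<in> vec ` M" for x
      using that norm_vec_schwartz_le[OF S inv] by (auto simp: h)
    have "h (vec a + vec b) = h (vec a) + h (vec b)" if "a \<in> M" "b \<in> M" for a b
    proof -
      have "h (vec a + vec b) = vec (\<Psi> (a + b))" using that by (simp add: vec_add[symmetric] h M_intros)
      then show ?thesis using that by (simp add: lin vec_add im h)
    qed
    moreover have "h (c *\<^sub>C vec a) = c *\<^sub>C h (vec a)" if "a \<in> M" for a c
    proof -
      have "h (c *\<^sub>C vec a) = vec (\<Psi> (c *\<^sub>C a))" using that by (simp add: vec_scaleC[symmetric] h M_intros)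
      then show ?thesis using that by (simp add: lin vec_scaleC im h)
    qed
    ultimately show "clinear_on (vec ` M) h" unfolding clinear_on_def by blast
  qed blast
  have "U = W"
    unfolding U_def gns_contraction_def
  proof (rule the_equality)
    show "W \<in> cbounded_ops \<and> norm W \<le> 1 \<and> (\<forall>a\<in>M. W (vec a) = vec (\<Psi> a))"
      using W h by auto
    show "W' = W" if "W' \<in> cbounded_ops \<and> norm W' \<le> 1 \<and> (\<forall>a\<in>M. blinfun_apply W' (vec a) = vec (\<Psi> a))" for W'
      using that W h by (intro eq_if_eq_on_vec) auto
  qed
  then show "U \<in> cbounded_ops" "norm U \<le> 1" "\<And>a. a \<in> M \<Longrightarrow> U (vec a) = vec (\<Psi> a)"
    using W h by auto
qed

subsection \<open>Operators that map the cyclic subspace into itself\<close>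

text \<open>For \<open>c\<close> in the commutant, commutation with every \<open>a n\<close> is an
  identity between matrix coefficients once \<open>c\<close> is moved to the left as its adjoint. It
  survives weak limits, so the limit lies in the bicommutant.\<close>

lemma weak_limit_in_algebra:
  assumes F: "F \<noteq> bot" and a: "\<And>n. a n \<in> M" and b: "b \<in> cbounded_ops"
    and lim: "\<And>x y. ((\<lambda>n. cinner x (a n y)) \<longlongrightarrow> cinner x (blinfun_apply b y)) F"
  shows "b \<in> M"
proof -
  have "c o\<^sub>L b = b o\<^sub>L c" if c: "c \<in> commutant M" for c
  proof (rule blinfun_eqI, rule cinner_ext)
    fix x y
    have cc: "c \<in> cbounded_ops" and comm: "\<And>n. a n o\<^sub>L c = c o\<^sub>L a n"
      using c a by (auto simp: commutant_def)
    have "cinner x (a n (c y)) = cinner ((c\<^sup>\<dagger>) x) (a n y)" for n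
      using arg_cong[OF comm[of n], of "\<lambda>d. blinfun_apply d y"] by (simp add: cinner_cadjoint_left[OF cc])
    then have "((\<lambda>n. cinner x (a n (c y))) \<longlongrightarrow> cinner ((c\<^sup>\<dagger>) x) (b y)) F"
      using lim by simp
    then have "cinner x (b (c y)) = cinner ((c\<^sup>\<dagger>) x) (b y)"
      using tendsto_unique[OF F] lim by blast
    then show "cinner x ((c o\<^sub>L b) y) = cinner x ((b o\<^sub>L c) y)" by (simp add: cinner_cadjoint_left[OF cc])
  qed
  then have "b \<in> commutant (commutant M)" using b by (simp add: commutant_def[of "commutant M"])
  then show ?thesis using vN by (simp add: von_neumann_algebra_def)
qed

text \<open>On bounded families weak convergence is ultraweak, and there normality of the state
  applies; left multiplication by \<open>c\<close> only changes the test vectors.\<close>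

lemma state_weak_limit:
  assumes F: "F \<noteq> bot" and a: "\<And>n. a n \<in> M" "\<And>n. norm (a n) \<le> C" and b: "b \<in> M" and c: "c \<in> M"
    and lim: "\<And>x y. ((\<lambda>n. cinner x (a n y)) \<longlongrightarrow> cinner x (blinfun_apply b y)) F"
  shows "((\<lambda>n. \<phi> (c o\<^sub>L a n)) \<longlongrightarrow> \<phi> (c o\<^sub>L b)) F"
proof -
  have "limitin ultraweak_topology (\<lambda>n. c o\<^sub>L a n) (c o\<^sub>L b) F"
  proof (rule limitin_ultraweak_if_bounded[OF F])
    show "norm (c o\<^sub>L a n) \<le> norm c * C" for n
      by (rule norm_blinfun_compose_le_mult[OF order_refl a(2)])
    show "((\<lambda>n. cinner x ((c o\<^sub>L a n) y)) \<longlongrightarrow> cinner x ((c o\<^sub>L b) y)) F" for x y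
      using lim[of "(c\<^sup>\<dagger>) x" y] by (simp add: cinner_cadjoint_left[OF M_cb[OF c]])
  qed
  then have "limitin (subtopology ultraweak_topology M) (\<lambda>n. c o\<^sub>L a n) (c o\<^sub>L b) F"
    using a b c by (simp add: limitin_subtopology M_intros)
  from continuous_map_limit[OF state_normal this] show ?thesis by (simp add: o_def)
qed

text \<open>A weak cluster point \<open>b\<close> of the bounded sequence supplies the algebra
  element. The limit of the adjoint vectors is tracked separately, since convergence of
  \<open>vec (a n)\<close> gives no control over \<open>vec ((a n)\<^sup>\<dagger>)\<close>.\<close>

lemma bounded_limit_in_cyclic_subspace:
  assumes a: "\<And>n. a n \<in> M" "\<And>n. norm (a n) \<le> C"
    and x: "(\<lambda>n. vec (a n)) \<longlonglongrightarrow> x" and y: "(\<lambda>n. vec ((a n)\<^sup>\<dagger>)) \<longlonglongrightarrow> y"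
  obtains b where "b \<in> M" "norm b \<le> C" "vec b = x" "vec (b\<^sup>\<dagger>) = y"
proof -
  have acb: "a n \<in> cbounded_ops" for n by (rule M_cb[OF a(1)])
  obtain F b where F: "F \<noteq> bot" "F \<le> sequentially" and b: "b \<in> cbounded_ops" "norm b \<le> C"
    and lim: "\<And>u v. ((\<lambda>n. cinner u (a n v)) \<longlongrightarrow> cinner u (blinfun_apply b v)) F"
    using bounded_operators_weak_cluster_point[of a C, OF a(2) acb] by blast
  have bM: "b \<in> M" by (rule weak_limit_in_algebra[OF F(1) a(1) b(1) lim])
  have adj: "cinner u ((d\<^sup>\<dagger>) v) = cnj (cinner v (blinfun_apply d u))" if "d \<in> M" for d u v
    unfolding cinner_cadjoint_right[OF M_cb[OF that]] by (rule cinner_commute)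
  have limadj: "((\<lambda>n. cinner u (((a n)\<^sup>\<dagger>) v)) \<longlongrightarrow> cinner u ((b\<^sup>\<dagger>) v)) F" for u v
    unfolding adj[OF a(1)] adj[OF bM] by (rule tendsto_cnj[OF lim])
  \<comment> \<open>Tested against \<open>vec c\<close>, the vectors converge to
    \<open>vec d\<close> by normality and to \<open>z\<close> by assumption, both along
    \<open>F\<close>. Applied to \<open>b\<close> and then to its adjoint.\<close>
  have key: "vec d = z"
    if d: "\<And>n. d' n \<in> M" "\<And>n. norm (d' n) \<le> C" "d \<in> M"
      and dl: "\<And>u v. ((\<lambda>n. cinner u (d' n v)) \<longlongrightarrow> cinner u (blinfun_apply d v)) F"
      and z: "(\<lambda>n. vec (d' n)) \<longlonglongrightarrow> z" for d d' z
  proof (rule eq_if_cinner_vec_eq)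
    fix c assume c: "c \<in> M"
    have "((\<lambda>n. \<phi> (c\<^sup>\<dagger> o\<^sub>L d' n)) \<longlongrightarrow> \<phi> (c\<^sup>\<dagger> o\<^sub>L d)) F"
      by (rule state_weak_limit[OF F(1) d(1,2,3) M_intros(1)[OF c] dl])
    then have "((\<lambda>n. cinner (vec c) (vec (d' n))) \<longlongrightarrow> cinner (vec c) (vec d)) F"
      using c d by (simp add: cinner_vec)
    moreover have "((\<lambda>n. cinner (vec c) (vec (d' n))) \<longlongrightarrow> cinner (vec c) z) F"
      by (rule tendsto_mono[OF F(2)]) (rule cinner.tendsto[OF tendsto_const z])
    ultimately show "cinner (vec c) (vec d) = cinner (vec c) z" by (rule tendsto_unique[OF F(1)])
  qed
  have "vec b = x" by (rule key[OF a bM lim x])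
  moreover have "vec (b\<^sup>\<dagger>) = y"
    by (rule key[OF _ _ M_intros(1)[OF bM] limadj y])
      (use a norm_cadjoint[OF M_cb[OF a(1)]] in \<open>auto intro: M_intros\<close>)
  ultimately show thesis using that bM b by blast
qed

text \<open>The operator \<open>X\<close> on the GNS space comes from a norm-decreasing \<open>*\<close>-preserving map of \<open>M\<close>.\<close>
definition implementable :: "('k \<Rightarrow>\<^sub>L 'k) \<Rightarrow> bool" where
  "implementable X \<longleftrightarrow> (\<forall>a\<in>M. \<exists>b\<in>M. norm b \<le> norm a \<and> X (vec a) = vec b \<and> X (vec (a\<^sup>\<dagger>)) = vec (b\<^sup>\<dagger>))"

lemma implementable_compose:
  assumes "implementable X" "implementable Y"
  shows "implementable (X o\<^sub>L Y)"
  unfolding implementable_def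
proof
  fix a assume "a \<in> M"
  then obtain b where b: "b \<in> M" "norm b \<le> norm a" "Y (vec a) = vec b" "Y (vec (a\<^sup>\<dagger>)) = vec (b\<^sup>\<dagger>)"
    using assms unfolding implementable_def by blast
  then obtain c where "c \<in> M" "norm c \<le> norm b" "X (vec b) = vec c" "X (vec (b\<^sup>\<dagger>)) = vec (c\<^sup>\<dagger>)"
    using assms unfolding implementable_def by blast
  then show "\<exists>b\<in>M. norm b \<le> norm a \<and> (X o\<^sub>L Y) (vec a) = vec b \<and> (X o\<^sub>L Y) (vec (a\<^sup>\<dagger>)) = vec (b\<^sup>\<dagger>)"
    using b by (intro bexI[of _ c]) auto
qed

lemma implementable_op_power:
  assumes "implementable X"
  shows "implementable (op_power X n)"
proof (induction n)
  case 0
  show ?case by (auto simp: implementable_def)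
qed (simp add: implementable_compose assms)

text \<open>The implementing elements for \<open>A n\<close> at a given \<open>a\<close> all have
  norm at most that of \<open>a\<close>, which is the boundedness required by the compactness
  argument.\<close>

lemma implementable_strong_limit:
  assumes A: "\<And>n. implementable (A n)" and lim: "\<And>x. (\<lambda>n. A n x) \<longlonglongrightarrow> blinfun_apply X x"
  shows "implementable X"
  unfolding implementable_def
proof
  fix a assume a: "a \<in> M"
  then have "\<forall>n. \<exists>b. b \<in> M \<and> norm b \<le> norm a \<and> A n (vec a) = vec b \<and> A n (vec (a\<^sup>\<dagger>)) = vec (b\<^sup>\<dagger>)"
    using A unfolding implementable_def by blast
  then obtain b where b: "\<And>n. b n \<in> M" "\<And>n. norm (b n) \<le> norm a"
    "\<And>n. A n (vec a) = vec (b n)" "\<And>n. A n (vec (a\<^sup>\<dagger>)) = vec ((b n)\<^sup>\<dagger>)" by metis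
  have "(\<lambda>n. vec (b n)) \<longlonglongrightarrow> X (vec a)" "(\<lambda>n. vec ((b n)\<^sup>\<dagger>)) \<longlonglongrightarrow> X (vec (a\<^sup>\<dagger>))"
    using lim by (simp_all flip: b)
  from bounded_limit_in_cyclic_subspace[OF b(1,2) this]
  show "\<exists>b\<in>M. norm b \<le> norm a \<and> X (vec a) = vec b \<and> X (vec (a\<^sup>\<dagger>)) = vec (b\<^sup>\<dagger>)" by metis
qed

lemma implementable_V_plus_seq:
  "implementable T \<Longrightarrow> implementable (T\<^sup>\<dagger>) \<Longrightarrow> implementable (V_plus_seq T n)"
  unfolding V_plus_seq_def by (intro implementable_compose implementable_op_power)

lemma implementable_schwartz:
  assumes S: "unital_schwartz_map M \<Psi>" and U: "\<And>a. a \<in> M \<Longrightarrow> blinfun_apply U (vec a) = vec (\<Psi> a)"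
  shows "implementable U"
  unfolding implementable_def
proof
  fix a assume a: "a \<in> M"
  show "\<exists>b\<in>M. norm b \<le> norm a \<and> U (vec a) = vec b \<and> U (vec (a\<^sup>\<dagger>)) = vec (b\<^sup>\<dagger>)"
    using a U M_intros(1)[OF a] unital_schwartz_mapD(1)[OF S a]
      schwartz_map_norm_le[OF M_star M_closed S a] schwartz_map_cadjoint[OF M_star M_closed S a]
    by (intro bexI[of _ "\<Psi> a"]) simp_all
qed

end

section \<open>The reversible subspace\<close>

text \<open>Applying the positive map \<open>\<Psi>\<close> to the Schwartz defect of the previous
  iterate, then using the Schwartz inequality of \<open>\<Psi>\<close> at its value, gives the next
  inequality. Thus the norm criterion is available for every iterate.\<close>

lemma unital_schwartz_map_iterate:
  assumes M: "star_subalgebra M" "closed M" and S: "unital_schwartz_map M \<Psi>"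
  shows "unital_schwartz_map M (\<Psi> ^^ n)"
proof (induction n)
  case 0
  have "op_le 0 (a\<^sup>\<dagger> o\<^sub>L a)" if "a \<in> M" for a
    using that star_subalgebra_cbounded[OF M(1)] by (intro cadjoint_square_positive)
  moreover have "op_le b b" for b :: "'a \<Rightarrow>\<^sub>L 'a"
    by (simp add: op_le_def cinner.zero_right)
  moreover have "continuous_map (subtopology ultraweak_topology M) (subtopology ultraweak_topology M) (\<lambda>a. a)"
    by (simp add: continuous_map_id[unfolded id_def])
  ultimately show ?case by (simp add: unital_schwartz_map_def clinear_on_def id_def)
next
  case (Suc n)
  define \<Xi> where "\<Xi> = \<Psi> ^^ n"
  have X: "unital_schwartz_map M \<Xi>" using Suc by (simp add: \<Xi>_def)
  note imX = unital_schwartz_mapD(1)[OF X] and imS = unital_schwartz_mapD(1)[OF S]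
  note closed = star_subalgebra_closed[OF M(1)]
  have main: "op_le 0 (\<Psi> (\<Xi> (a\<^sup>\<dagger>)) o\<^sub>L \<Psi> (\<Xi> a)) \<and> op_le (\<Psi> (\<Xi> (a\<^sup>\<dagger>)) o\<^sub>L \<Psi> (\<Xi> a)) (\<Psi> (\<Xi> (a\<^sup>\<dagger> o\<^sub>L a)))"
    if a: "a \<in> M" for a
  proof
    have ad: "a\<^sup>\<dagger> \<in> M" "a\<^sup>\<dagger> o\<^sub>L a \<in> M" by (intro closed a)+
    have eq: "\<Xi> (a\<^sup>\<dagger>) = (\<Xi> a)\<^sup>\<dagger>" by (rule schwartz_map_cadjoint[OF M X a])
    have m: "(\<Xi> a)\<^sup>\<dagger> o\<^sub>L \<Xi> a \<in> M" by (intro closed imX a)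
    show "op_le 0 (\<Psi> (\<Xi> (a\<^sup>\<dagger>)) o\<^sub>L \<Psi> (\<Xi> a))"
      unfolding eq by (rule unital_schwartz_mapD(4)[OF S imX[OF a]])
    have "op_le 0 (\<Psi> (\<Xi> (a\<^sup>\<dagger> o\<^sub>L a) - ((\<Xi> a)\<^sup>\<dagger> o\<^sub>L \<Xi> a)))"
      using unital_schwartz_mapD(5)[OF X a] imX[OF ad(2)] m
      by (intro schwartz_map_positive[OF M S]) (simp_all add: closed op_le_zero_diff eq)
    then have "op_le (\<Psi> ((\<Xi> a)\<^sup>\<dagger> o\<^sub>L \<Xi> a)) (\<Psi> (\<Xi> (a\<^sup>\<dagger> o\<^sub>L a)))"
      using clinear_onD(4)[OF unital_schwartz_mapD(2)[OF S] imX[OF ad(2)] m closed(2)[OF m]]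
      by (simp add: op_le_zero_diff)
    with unital_schwartz_mapD(5)[OF S imX[OF a]]
    show "op_le (\<Psi> (\<Xi> (a\<^sup>\<dagger>)) o\<^sub>L \<Psi> (\<Xi> a)) (\<Psi> (\<Xi> (a\<^sup>\<dagger> o\<^sub>L a)))"
      unfolding eq by (rule op_le_trans)
  qed
  have "clinear_on M (\<lambda>a. \<Psi> (\<Xi> a))"
    using unital_schwartz_mapD(2)[OF S] unital_schwartz_mapD(2)[OF X] imX
    by (simp add: clinear_on_def)
  moreover have "continuous_map (subtopology ultraweak_topology M) (subtopology ultraweak_topology M) (\<Psi> \<circ> \<Xi>)"
    using S X by (intro continuous_map_compose) (auto simp: unital_schwartz_map_def)
  ultimately have "unital_schwartz_map M (\<lambda>a. \<Psi> (\<Xi> a))"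
    using main imX imS unital_schwartz_mapD(3)[OF S] unital_schwartz_mapD(3)[OF X]
    unfolding unital_schwartz_map_def by (simp add: o_def)
  then show ?case by (simp add: \<Xi>_def o_def)
qed

lemma D_infinity_eq: "D_infinity M \<Phi> \<Psi> = (\<Inter>n. mult_domain M (\<Phi> ^^ n) \<inter> mult_domain M (\<Psi> ^^ n))"
proof
  show "D_infinity M \<Phi> \<Psi> \<subseteq> (\<Inter>n. mult_domain M (\<Phi> ^^ n) \<inter> mult_domain M (\<Psi> ^^ n))"
  proof (intro INT_greatest Int_greatest)
    fix n
    have 1: "D_infinity M \<Phi> \<Psi> \<subseteq> mult_domain M (int_iterate \<Phi> \<Psi> k)" for k
      by (auto simp: D_infinity_def)
    show "D_infinity M \<Phi> \<Psi> \<subseteq> mult_domain M (\<Phi> ^^ n)"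
      using 1[of "int n"] by (simp add: int_iterate_def)
    \<comment> \<open>For \<open>n = 0\<close> the index is 0 and selects the nonnegative branch;
      both zeroth iterates are the identity.\<close>
    show "D_infinity M \<Phi> \<Psi> \<subseteq> mult_domain M (\<Psi> ^^ n)"
      using 1[of "- int n"] 1[of 0] by (cases "n = 0") (simp_all add: int_iterate_def)
  qed
qed (auto simp: D_infinity_def int_iterate_def)

lemma H_zero_cadjoint: "U \<in> cbounded_ops \<Longrightarrow> H_zero (U\<^sup>\<dagger>) = H_zero U"
  unfolding H_zero_def cadjoint_cadjoint by metis

text \<open>Reduces the statement about the second limit to the first one for the adjoint.\<close>

lemma V_minus_seq_eq: "U \<in> cbounded_ops \<Longrightarrow> V_minus_seq U = V_plus_seq (U\<^sup>\<dagger>)"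
  by (rule ext) (simp add: V_minus_seq_def V_plus_seq_def cadjoint_cadjoint)

lemma orth_projection_eqI:
  fixes R :: "'k::chilbert_space \<Rightarrow>\<^sub>L 'k"
  assumes R: "R \<in> cbounded_ops" and sym: "\<And>x y. inner (R x) y = inner x (R y)"
    and im: "\<And>x. R x \<in> S" and fixed: "\<And>x. x \<in> S \<Longrightarrow> R x = x"
  shows "orth_projection S = R"
  unfolding orth_projection_def
proof (rule the_equality)
  have sa: "R\<^sup>\<dagger> = R" using selfadjoint_iff_inner[OF R] sym by blast
  then have csym: "cinner y (R x) = cinner (R y) x" for x y
    using cinner_cadjoint_right[OF R, of y x] by simp
  show "\<forall>x. R x \<in> S \<and> (\<forall>y\<in>S. cinner y (x - R x) = 0)"
    using im fixed by (simp add: cinner.diff_right csym)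
  show "P = R" if P: "\<forall>x. blinfun_apply P x \<in> S \<and> (\<forall>y\<in>S. cinner y (x - blinfun_apply P x) = 0)" for P
  proof (rule blinfun_eqI)
    fix x
    \<comment> \<open>The residual is orthogonal to \<open>S\<close>, which contains the range of
      \<open>R\<close>; symmetry of \<open>R\<close> moves it onto the test vector.\<close>
    have "R (x - P x) = 0"
    proof (rule cinner_ext)
      fix y
      show "cinner y (R (x - P x)) = cinner y 0"
        using P im[of y] by (simp add: csym cinner.zero_right)
    qed
    then show "P x = R x" using fixed[of "P x"] P by (simp add: blinfun.diff_right)
  qed
qed

context gns_state
begin

lemma state_adjoint_invariant:
  assumes "state_adjoint M \<phi> \<Phi> \<Psi>" "unital_schwartz_map M \<Phi>" "a \<in> M"
  shows "\<phi> (\<Psi> a) = \<phi> a"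
proof -
  \<comment> \<open>The duality relation is evaluated at the identity, which \<open>\<Phi>\<close>
    fixes.\<close>
  have "\<phi> (a o\<^sub>L \<Phi> id_blinfun) = \<phi> (\<Psi> a o\<^sub>L id_blinfun)"
    using assms M_id by (simp add: state_adjoint_def)
  moreover have "a o\<^sub>L id_blinfun = a" "\<Psi> a o\<^sub>L id_blinfun = \<Psi> a" by (rule blinfun_eqI, simp)+
  ultimately show ?thesis by (simp add: unital_schwartz_mapD(3)[OF assms(2)])
qed

lemma cadjoint_implements_state_adjoint:
  assumes adj: "state_adjoint M \<phi> \<Phi> \<Psi>" and S: "unital_schwartz_map M \<Phi>"
    and U: "U \<in> cbounded_ops" "\<And>a. a \<in> M \<Longrightarrow> blinfun_apply U (vec a) = vec (\<Phi> a)" and b: "b \<in> M"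
  shows "(U\<^sup>\<dagger>) (vec b) = vec (\<Psi> b)"
proof (rule eq_if_cinner_vec_eq, rule cinner_eq_swap)
  fix c assume c: "c \<in> M"
  have T: "unital_schwartz_map M \<Psi>" using adj by (simp add: state_adjoint_def)
  have im: "\<Phi> c \<in> M" "\<Psi> b \<in> M" "b\<^sup>\<dagger> \<in> M"
    using unital_schwartz_mapD(1)[OF S c] unital_schwartz_mapD(1)[OF T b] M_intros(1)[OF b] by auto
  have "cinner ((U\<^sup>\<dagger>) (vec b)) (vec c) = \<phi> (b\<^sup>\<dagger> o\<^sub>L \<Phi> c)"
    using b c im by (simp add: cinner_cadjoint_left[OF U(1)] U(2) cinner_vec)
  also have "\<dots> = \<phi> (\<Psi> (b\<^sup>\<dagger>) o\<^sub>L c)" using adj c im by (simp add: state_adjoint_def)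
  also have "\<dots> = cinner (vec (\<Psi> b)) (vec c)"
    using c im by (simp add: cinner_vec schwartz_map_cadjoint[OF M_star M_closed T b])
  finally show "cinner ((U\<^sup>\<dagger>) (vec b)) (vec c) = cinner (vec (\<Psi> b)) (vec c)" .
qed

end

text \<open>The assumptions are symmetric under exchanging \<open>\<Phi>\<close> with
  \<open>\<Psi>\<close> and \<open>U\<close> with its adjoint, so each result has a dual through
  \<open>dual\<close>.\<close>

locale gns_dynamics = gns_state +
  fixes \<Phi> \<Psi> :: "('a \<Rightarrow>\<^sub>L 'a) \<Rightarrow> 'a \<Rightarrow>\<^sub>L 'a" and U :: "'b \<Rightarrow>\<^sub>L 'b"
  assumes schwartz: "unital_schwartz_map M \<Phi>" "unital_schwartz_map M \<Psi>"
    and invariant: "\<And>a. a \<in> M \<Longrightarrow> \<phi> (\<Phi> a) = \<phi> a" "\<And>a. a \<in> M \<Longrightarrow> \<phi> (\<Psi> a) = \<phi> a"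
    and U: "U \<in> cbounded_ops" "norm U \<le> 1"
    and U_vec: "\<And>a. a \<in> M \<Longrightarrow> U (vec a) = vec (\<Phi> a)" "\<And>a. a \<in> M \<Longrightarrow> (U\<^sup>\<dagger>) (vec a) = vec (\<Psi> a)"
begin

lemma U_adj: "U\<^sup>\<dagger> \<in> cbounded_ops" "norm (U\<^sup>\<dagger>) \<le> 1"
  using cadjoint_in_cbounded_ops[OF U(1)] norm_cadjoint[OF U(1)] U(2) by simp_all

lemma dual: "gns_dynamics M \<phi> \<pi> \<Omega> \<Psi> \<Phi> (U\<^sup>\<dagger>)"
  by unfold_locales (use schwartz invariant U U_adj U_vec in \<open>auto simp: cadjoint_cadjoint\<close>)

lemma iterate_in: "a \<in> M \<Longrightarrow> (\<Phi> ^^ n) a \<in> M"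
  by (induction n) (auto intro: unital_schwartz_mapD(1)[OF schwartz(1)])

lemma iterate_invariant: "a \<in> M \<Longrightarrow> \<phi> ((\<Phi> ^^ n) a) = \<phi> a"
  by (induction n) (auto simp: invariant iterate_in)

lemma op_power_vec: "a \<in> M \<Longrightarrow> op_power U n (vec a) = vec ((\<Phi> ^^ n) a)"
  by (induction n) (auto simp: U_vec iterate_in)

lemma mult_domain_iterate_iff:
  "a \<in> mult_domain M (\<Phi> ^^ n) \<longleftrightarrow> a \<in> M \<and> norm (op_power U n (vec a)) = norm (vec a) \<and>
    norm (op_power U n (vec (a\<^sup>\<dagger>))) = norm (vec (a\<^sup>\<dagger>))"
  using mult_domain_iff[OF unital_schwartz_map_iterate[OF M_star M_closed schwartz(1)] iterate_invariant, of a n]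
  by (auto simp: op_power_vec M_intros)

text \<open>The iterates of \<open>\<Phi>\<close> correspond to powers of \<open>U\<close>, those of
  \<open>\<Psi>\<close> to powers of its adjoint; the norm criterion for all of them together is
  membership in \<open>H_zero U\<close>, once for \<open>a\<close> and once for its adjoint.\<close>

lemma D_infinity_iff:
  "a \<in> D_infinity M \<Phi> \<Psi> \<longleftrightarrow> a \<in> M \<and> vec a \<in> H_zero U \<and> vec (a\<^sup>\<dagger>) \<in> H_zero U"
proof -
  interpret dual: gns_dynamics M \<phi> \<pi> \<Omega> \<Psi> \<Phi> "U\<^sup>\<dagger>" by (rule dual)
  show ?thesis
    by (auto simp: D_infinity_eq H_zero_def mult_domain_iterate_iff dual.mult_domain_iterate_iff)
qed

text \<open>The projection is built as an iterated strong limit of products of implementable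
  operators, rather than by minimising distances, because \<open>implementable P\<close> is the
  property needed later.\<close>

lemma H_zero_projection:
  defines "P \<equiv> orth_projection (H_zero U)"
  shows "P \<in> cbounded_ops" "\<And>x y. inner (P x) y = inner x (P y)"
    "\<And>x. P x \<in> H_zero U" "\<And>x. x \<in> H_zero U \<Longrightarrow> P x = x" "implementable P"
proof -
  define V W where "V = sot_lim (V_plus_seq U)" and "W = sot_lim (V_plus_seq (U\<^sup>\<dagger>))"
  note V = V_plus_seq_limit[OF U, folded V_def] and W = V_plus_seq_limit[OF U_adj, folded W_def]
  have impU: "implementable U" "implementable (U\<^sup>\<dagger>)"
    using implementable_schwartz[OF schwartz(1) U_vec(1)] implementable_schwartz[OF schwartz(2) U_vec(2)] by auto
  have impV: "implementable V"
    by (rule implementable_strong_limit[of "V_plus_seq U", OF _ V(2)])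
      (rule implementable_V_plus_seq[OF impU])
  have impW: "implementable W"
    by (rule implementable_strong_limit[of "V_plus_seq (U\<^sup>\<dagger>)", OF _ W(2)])
      (rule implementable_V_plus_seq[OF impU(2)], simp add: cadjoint_cadjoint U impU)
  have contr: "norm (blinfun_apply X x) \<le> norm x" if "norm X \<le> 1" for X :: "'b \<Rightarrow>\<^sub>L 'b" and x
    using norm_blinfun[of X x] mult_right_mono[OF that norm_ge_zero[of x]] by linarith
  \<comment> \<open>The symmetric order of the factors keeps \<open>B\<close> self-adjoint, so
    \<open>V_plus_seq B n\<close> is the even power \<open>B^(2n)\<close>.\<close>
  define B where "B = V o\<^sub>L (W o\<^sub>L V)"
  have Bc: "B \<in> cbounded_ops" by (rule cbounded_opsI) (simp add: B_def cbounded_opsD[OF V(3)] cbounded_opsD[OF W(3)])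
  have Bn: "norm B \<le> 1"
    using norm_blinfun_compose_le_mult[OF V(1) norm_blinfun_compose_le_mult[OF W(1) V(1)]] by (simp add: B_def)
  have Bsym: "inner (B x) y = inner x (B y)" for x y by (simp add: B_def V(4) W(4))
  have Badj: "B\<^sup>\<dagger> = B" using selfadjoint_iff_inner[OF Bc] Bsym by blast
  define R where "R = sot_lim (V_plus_seq B)"
  note R = V_plus_seq_limit[OF Bc Bn, folded R_def]
  have impB: "implementable B"
    unfolding B_def by (intro implementable_compose impV impW)
  have impR: "implementable R"
    by (rule implementable_strong_limit[of "V_plus_seq B", OF _ R(2)])
      (rule implementable_V_plus_seq[OF impB], simp add: Badj impB)
  \<comment> \<open>If \<open>B\<close> preserves the norm of \<open>x\<close>, no factor of the
    product loses norm; so \<open>V\<close> and then \<open>W\<close> fix \<open>x\<close>.\<close>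
  have fix_H: "x \<in> H_zero U" if x: "norm (B x) = norm x" for x
  proof -
    have 1: "norm (B x) \<le> norm (W (V x))" "norm (W (V x)) \<le> norm (V x)" "norm (V x) \<le> norm x"
      using contr[OF V(1)] contr[OF W(1)] by (simp_all add: B_def)
    then have "V x = x" using x by (intro V(6)) simp
    moreover from this have "W x = x" using x 1 by (intro W(6)) simp
    ultimately show ?thesis using V(5)[of x] W(5)[of x] by (simp add: H_zero_def)
  qed
  have H_fix: "R x = x" if "x \<in> H_zero U" for x
  proof -
    have "V x = x" "W x = x" using that V(5)[of x] W(5)[of x] by (simp_all add: H_zero_def)
    then have "op_power B n x = x" for n by (induction n) (simp_all add: B_def)
    then show ?thesis by (simp add: R(5))
  qed
  have R_H: "R x \<in> H_zero U" for x
  proof (rule fix_H)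
    \<comment> \<open>Passing to the limit in this recursion shows that \<open>B^2\<close> fixes
      \<open>R x\<close>; as \<open>B\<close> is a contraction, it cannot shrink
      \<open>R x\<close>.\<close>
    have "V_plus_seq B (Suc n) x = B (B (V_plus_seq B n x))" for n
      by (simp add: V_plus_seq_def Badj op_power_apply_commute)
    moreover have "(\<lambda>n. B (B (V_plus_seq B n x))) \<longlonglongrightarrow> B (B (R x))"
      by (intro blinfun.tendsto tendsto_const R(2))
    ultimately have "(\<lambda>n. V_plus_seq B (Suc n) x) \<longlonglongrightarrow> B (B (R x))" by simp
    then have "B (B (R x)) = R x" by (rule LIMSEQ_unique) (rule LIMSEQ_Suc[OF R(2)])
    with contr[OF Bn, of "B (R x)"] have "norm (R x) \<le> norm (B (R x))" by simp
    with contr[OF Bn] show "norm (B (R x)) = norm (R x)" by (rule order.antisym)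
  qed
  have P: "P = R" unfolding P_def by (rule orth_projection_eqI[OF R(3,4) R_H H_fix])
  show "P \<in> cbounded_ops" unfolding P by (rule R(3))
  show "inner (P x) y = inner x (P y)" for x y unfolding P by (rule R(4))
  show "P x \<in> H_zero U" for x unfolding P by (rule R_H)
  show "P x = x" if "x \<in> H_zero U" for x unfolding P by (rule H_fix[OF that])
  show "implementable P" unfolding P by (rule impR)
qed

text \<open>Implementability supplies \<open>b\<close> with \<open>vec b\<close> and
  \<open>vec (b\<^sup>\<dagger>)\<close> both in the range of \<open>P\<close>, which says that
  \<open>b\<close> lies in \<open>D_infinity\<close>. Density then yields the closure, and
  \<open>a - b\<close> is the element orthogonal to \<open>D_infinity\<close>.\<close>

proposition closure_D_infinity_and_projection:
  defines "P \<equiv> orth_projection (H_zero U)"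
  shows "closure (vec ` D_infinity M \<Phi> \<Psi>) = H_zero U"
    and "\<And>a. a \<in> M \<Longrightarrow> \<exists>d\<in>state_perp M \<phi> (D_infinity M \<Phi> \<Psi>). vec a - P (vec a) = vec d"
proof -
  define Hinf where "Hinf = closure (vec ` D_infinity M \<Phi> \<Psi>)"
  note R = H_zero_projection[folded P_def]
  have csym: "cinner x (P y) = cinner (P x) y" for x y
    using selfadjoint_iff_inner[OF R(1)] R(2) cinner_cadjoint_right[OF R(1), of x y] by simp
  have E: "\<exists>b\<in>D_infinity M \<Phi> \<Psi>. P (vec a) = vec b" if a: "a \<in> M" for a
  proof -
    obtain b where b: "b \<in> M" "P (vec a) = vec b" "P (vec (a\<^sup>\<dagger>)) = vec (b\<^sup>\<dagger>)"
      using R(5) a unfolding implementable_def by blast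
    then have "b \<in> D_infinity M \<Phi> \<Psi>" using R(3)[of "vec a"] R(3)[of "vec (a\<^sup>\<dagger>)"] by (simp add: D_infinity_iff)
    then show ?thesis using b by blast
  qed
  have HR: "H_zero U = {x. P x = x}" using R(3,4) by auto (metis R(3))
  have "closed (H_zero U)" unfolding HR by (intro closed_Collect_eq continuous_intros)
  moreover have "vec ` D_infinity M \<Phi> \<Psi> \<subseteq> H_zero U" by (auto simp: D_infinity_iff)
  ultimately have 1: "Hinf \<subseteq> H_zero U" unfolding Hinf_def by (intro closure_minimal)
  have "closed {x. P x \<in> Hinf}"
  proof -
    have "closed (blinfun_apply P -` Hinf)"
      unfolding Hinf_def by (intro continuous_closed_vimage closed_closure) (simp add: linear_continuous_at blinfun.bounded_linear_right)
    then show ?thesis by (simp add: vimage_def)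
  qed
  moreover have "vec ` M \<subseteq> {x. P x \<in> Hinf}"
    using E closure_subset unfolding Hinf_def by fastforce
  ultimately have "closure (vec ` M) \<subseteq> {x. P x \<in> Hinf}" by (intro closure_minimal)
  then have "P x \<in> Hinf" for x unfolding dense by auto
  then have "H_zero U \<subseteq> Hinf" by (metis R(4) subsetI)
  with 1 show "closure (vec ` D_infinity M \<Phi> \<Psi>) = H_zero U" unfolding Hinf_def by blast
  show "\<exists>d\<in>state_perp M \<phi> (D_infinity M \<Phi> \<Psi>). vec a - P (vec a) = vec d" if a: "a \<in> M" for a
  proof -
    obtain b where b: "b \<in> D_infinity M \<Phi> \<Psi>" "P (vec a) = vec b" using E[OF a] by blast
    then have bM: "b \<in> M" by (simp add: D_infinity_iff)
    have d: "a - b \<in> M" "vec a - P (vec a) = vec (a - b)"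
      using a bM b by (simp_all add: M_intros vec_diff)
    have "\<phi> ((a - b)\<^sup>\<dagger> o\<^sub>L x) = 0" if x: "x \<in> D_infinity M \<Phi> \<Psi>" for x
    proof -
      have xM: "x \<in> M" "P (vec x) = vec x" using x R(4) by (simp_all add: D_infinity_iff)
      have RR: "P (P (vec a)) = P (vec a)" using R(3,4) by blast
      have "\<phi> ((a - b)\<^sup>\<dagger> o\<^sub>L x) = cinner (vec a - P (vec a)) (P (vec x))"
        using cinner_vec[OF d(1) xM(1)] d(2) xM(2) by simp
      also have "\<dots> = cinner (P (vec a - P (vec a))) (vec x)" by (rule csym)
      also have "\<dots> = 0" by (simp add: blinfun.diff_right RR cinner.zero_left)
      finally show ?thesis .
    qed
    then show ?thesis using d by (intro bexI[of _ "a - b"]) (simp_all add: state_perp_def)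
  qed
qed

text \<open>The squared norm of the n-th vector is the state of
  \<open>(a n)\<^sup>\<dagger> o\<^sub>L a n\<close>, which tends to zero ultraweakly, and the state
  is normal.\<close>

lemma op_power_vec_tendsto_zero:
  assumes d: "d \<in> M" and lim: "limitin ultrastrong_topology (\<lambda>n. (\<Phi> ^^ n) d) 0 sequentially"
  shows "(\<lambda>n. op_power U n (vec d)) \<longlonglongrightarrow> 0"
proof -
  define a where "a n = (\<Phi> ^^ n) d" for n
  have a: "a n \<in> M" for n using d by (simp add: a_def iterate_in)
  have "limitin ultraweak_topology (\<lambda>n. (a n)\<^sup>\<dagger> o\<^sub>L a n) 0 sequentially"
    by (rule limitin_ultraweak_cadjoint_square) (use lim a M_cb in \<open>auto simp: a_def\<close>)
  moreover have "0 \<in> M" using M_intros(3)[OF d, of 0] by simp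
  ultimately have "limitin (subtopology ultraweak_topology M) (\<lambda>n. (a n)\<^sup>\<dagger> o\<^sub>L a n) 0 sequentially"
    using a by (simp add: limitin_subtopology M_intros)
  from continuous_map_limit[OF state_normal this]
  have "(\<lambda>n. \<phi> ((a n)\<^sup>\<dagger> o\<^sub>L a n)) \<longlonglongrightarrow> \<phi> 0" by (simp add: o_def)
  then have "(\<lambda>n. Re (\<phi> ((a n)\<^sup>\<dagger> o\<^sub>L a n))) \<longlonglongrightarrow> Re (\<phi> 0)" by (rule tendsto_Re)
  moreover have "\<phi> (0 :: 'a \<Rightarrow>\<^sub>L 'a) = 0"
    using state_simps(3)[OF M_id, of 0] by simp
  ultimately have "(\<lambda>n. (norm (vec (a n)))\<^sup>2) \<longlonglongrightarrow> 0" using a by (simp add: norm_vec)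
  then have "(\<lambda>n. norm (vec (a n))) \<longlonglongrightarrow> 0" by simp
  then have "(\<lambda>n. vec (a n)) \<longlonglongrightarrow> 0" by (rule tendsto_norm_zero_cancel)
  then show ?thesis using d by (simp add: op_power_vec a_def)
qed

lemma V_plus_limit:
  "limitin strong_operator_topology (V_plus_seq U) (sot_lim (V_plus_seq U)) sequentially"
  using V_plus_seq_limit(2)[OF U] by (simp add: limitin_strong_operator_topology_iff)

text \<open>Each vector of the dense subspace splits into its projection, which \<open>V\<close>
  fixes, and a vector of \<open>state_perp\<close>, on which decay forces \<open>V\<close> to
  vanish.\<close>

theorem V_plus_eq_projection:
  defines "Hinf \<equiv> closure (vec ` D_infinity M \<Phi> \<Psi>)"
  assumes decay: "\<And>d. d \<in> state_perp M \<phi> (D_infinity M \<Phi> \<Psi>) \<Longrightarrow>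
    limitin ultrastrong_topology (\<lambda>n. (\<Phi> ^^ n) d) 0 sequentially"
  shows "Hinf = H_zero U" "sot_lim (V_plus_seq U) = orth_projection Hinf"
proof -
  define V P where "V = sot_lim (V_plus_seq U)" and "P = orth_projection (H_zero U)"
  note V = V_plus_seq_limit[OF U, folded V_def] and P = H_zero_projection[folded P_def]
  have "V = P"
  proof (rule eq_if_eq_on_vec)
    fix a assume "a \<in> M"
    then obtain d where d: "d \<in> state_perp M \<phi> (D_infinity M \<Phi> \<Psi>)" "vec a - P (vec a) = vec d"
      using closure_D_infinity_and_projection(2) unfolding P_def by blast
    have "V (vec d) = 0"
      using d(1) by (intro V(7) op_power_vec_tendsto_zero decay) (simp_all add: state_perp_def)
    then have "V (vec a) = V (P (vec a))" by (simp add: d(2)[symmetric] blinfun.diff_right)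
    also have "\<dots> = P (vec a)" using P(3)[of "vec a"] by (simp add: V(5) H_zero_def)
    finally show "V (vec a) = P (vec a)" .
  qed
  moreover show "Hinf = H_zero U" unfolding Hinf_def by (rule closure_D_infinity_and_projection)
  ultimately show "sot_lim (V_plus_seq U) = orth_projection Hinf" by (simp add: V_def P_def)
qed

end

theorem proposition12:
  fixes M :: "('h::chilbert_space \<Rightarrow>\<^sub>L 'h) set"
    and \<Phi> \<Phi>s :: "('h \<Rightarrow>\<^sub>L 'h) \<Rightarrow> ('h \<Rightarrow>\<^sub>L 'h)"
    and \<phi> :: "('h \<Rightarrow>\<^sub>L 'h) \<Rightarrow> complex"
    and \<pi> :: "('h \<Rightarrow>\<^sub>L 'h) \<Rightarrow> ('k::chilbert_space \<Rightarrow>\<^sub>L 'k)"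
    and \<Omega> :: 'k
    and U Pinf Vplus Vminus :: "'k \<Rightarrow>\<^sub>L 'k"
    and Dinf :: "('h \<Rightarrow>\<^sub>L 'h) set"
    and Hinf Hzero :: "'k set"
  assumes "quantum_dynamical_system M \<Phi> \<phi>"
    and "state_adjoint M \<phi> \<Phi> \<Phi>s"
    and "gns_representation M \<phi> \<pi> \<Omega>"
    and "U = gns_contraction M \<Phi> \<pi> \<Omega>"
    and "Dinf = D_infinity M \<Phi> \<Phi>s"
    and "Hinf = closure ((\<lambda>a. \<pi> a \<Omega>) ` Dinf)"
    and "Pinf = orth_projection Hinf"
    and "Hzero = H_zero U"
    and "Vplus = sot_lim (V_plus_seq U)"
    and "Vminus = sot_lim (V_minus_seq U)"
  shows "limitin strong_operator_topology (V_plus_seq U) Vplus sequentially \<and>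
    limitin strong_operator_topology (V_minus_seq U) Vminus sequentially \<and>
    ((\<forall>d\<in>state_perp M \<phi> Dinf. limitin ultrastrong_topology (\<lambda>n. (\<Phi> ^^ n) d) 0 sequentially)
      \<longrightarrow> Hinf = Hzero \<and> Vplus = Pinf) \<and>
    ((\<forall>d\<in>state_perp M \<phi> Dinf. limitin ultrastrong_topology (\<lambda>n. (\<Phi>s ^^ n) d) 0 sequentially)
      \<longrightarrow> Hinf = Hzero \<and> Vminus = Pinf)"
proof -
  have qds: "von_neumann_algebra M" "unital_schwartz_map M \<Phi>" "normal_faithful_state M \<phi>"
    "\<And>a. a \<in> M \<Longrightarrow> \<phi> (\<Phi> a) = \<phi> a" "unital_schwartz_map M \<Phi>s"
    using assms(1,2) by (auto simp: quantum_dynamical_system_def state_adjoint_def)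
  interpret gns_state M \<phi> \<pi> \<Omega>
    using qds assms(3) by unfold_locales
  note U = gns_contraction_properties[OF qds(2,4), folded assms(4)]
  interpret fwd: gns_dynamics M \<phi> \<pi> \<Omega> \<Phi> \<Phi>s U
  proof unfold_locales
    show "(U\<^sup>\<dagger>) (vec a) = vec (\<Phi>s a)" if "a \<in> M" for a
      by (rule cadjoint_implements_state_adjoint[OF assms(2) qds(2) U(1,3) that])
    show "\<phi> (\<Phi>s a) = \<phi> a" if "a \<in> M" for a
      by (rule state_adjoint_invariant[OF assms(2) qds(2) that])
  qed (use qds U in auto)
  \<comment> \<open>The second implication is the first one for the dual system, after identifying
    its \<open>D_infinity\<close>, its reversible subspace and its limit with those in the
    claim.\<close>
  interpret bwd: gns_dynamics M \<phi> \<pi> \<Omega> \<Phi>s \<Phi> "U\<^sup>\<dagger>" by (rule fwd.dual)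
  have D: "D_infinity M \<Phi>s \<Phi> = D_infinity M \<Phi> \<Phi>s" by (auto simp: D_infinity_eq)
  have Vm: "V_minus_seq U = V_plus_seq (U\<^sup>\<dagger>)" by (rule V_minus_seq_eq[OF U(1)])
  have Hz: "H_zero (U\<^sup>\<dagger>) = H_zero U" by (rule H_zero_cadjoint[OF U(1)])
  note bwd = bwd.V_plus_limit bwd.V_plus_eq_projection[unfolded D]
  show ?thesis
    using fwd.V_plus_limit fwd.V_plus_eq_projection bwd by (simp add: assms(5-10) Vm Hz)
qed

end
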